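(* Let $F$ be a field of characteristic zero and consider the subalgebras $M_1=Fe_{22}\oplus Fe_{12}$ and $M_2=Fe_{11}\oplus Fe_{12}$ of the algebra of $2\times 2$ matrices over $F$ ($e_{ij}$ are the matrix units). Let $\varepsilon$ denote the derivation of $M_1$ given by $\varepsilon(\alpha e_{22}+\beta e_{12})=\beta e_{12}$, and also the derivation of $M_2$ given by $\varepsilon(\alpha e_{11}+\beta e_{12})=\beta e_{12}$, for all $\alpha,\beta\in F$. Let $L=F\varepsilon$ be the one-dimensional Lie algebra spanned by $\varepsilon$, and let $M_1^\varepsilon$, $M_2^\varepsilon$ denote $M_1$, $M_2$ regarded as $L$-algebras via these derivations. Then: (1) $\mathrm{Id}^L(M_1^\varepsilon)=\langle xy^\varepsilon,\ x^\varepsilon y-y^\varepsilon x-[x,y],\ x^{\varepsilon^2}-x^\varepsilon\rangle_{T_L}$ and $\mathrm{Id}^L(M_2^\varepsilon)=\langle x^\varepsilon y,\ xy^\varepsilon-yx^\varepsilon-[x,y],\ x^{\varepsilon^2}-x^\varepsilon\rangle_{T_L}$; (2) $c_n^L(M_1^\varepsilon)=c_n^L(M_2^\varepsilon)=n+1$ for all $n\ge 1$; (3) $\chi_n^L(M_1^\varepsilon)=\chi_n^L(M_2^\varepsilon)=2\chi_{(n)}+\chi_{(n-1,1)}$ for all $n\ge 1$, where the term $\chi_{(n-1,1)}$ is omitted if $n=1$.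
   Context: An $L$-algebra is an associative algebra $A$ over $F$ (not necessarily unital) on which a Lie algebra $L$ acts by derivations; the action extends to the universal enveloping algebra $U(L)$, products acting by composition, i.e. $(gh)(a)=g(h(a))$. Fix a basis $\mathcal B\ni 1$ of $U(L)$. $F\langle X|L\rangle$ is the free associative algebra (without constant terms) on the free generators $x_j^{h}$, $h\in\mathcal B$, $j\in\mathbb N$; one writes $x_j=x_j^1$ and extends $x_j^h$ linearly to all $h\in U(L)$. $U(L)$ acts on it with each $\gamma\in L$ acting as the derivation with $\gamma(x_j^h)=x_j^{\gamma h}$; for a polynomial $f$ and $h\in U(L)$, $f^h=h(f)$. Elements are differential polynomials; $f(x_1,\dots,x_n)$ is a differential identity of $A$ if it vanishes under all substitutions $x_i\mapsto a_i\in A$ (with $x_i^h\mapsto h(a_i)$). $\mathrm{Id}^L(A)$ is the set of differential identities of $A$. A $T_L$-ideal is a two-sided ideal of $F\langle X|L\rangle$ stable under the $U(L)$-action and under all substitutions $x_j\mapsto g_j\in F\langle X|L\rangle$ (with $x_j^h\mapsto h(g_j)$); $\langle S\rangle_{T_L}$ is the $T_L$-ideal generated by $S$. Letters $x,y$ denote distinct variables of $X=\{x_1,x_2,\dots\}$, and $[x,y]=xy-yx$. $P_n^L=\mathrm{span}_F\{x_{\sigma(1)}^{h_1}\cdots x_{\sigma(n)}^{h_n}\mid \sigma\in S_n,\ h_i\in\mathcal B\}$ is the space of multilinear differential polynomials in $x_1,\dots,x_n$, with $S_n$ acting by $\sigma(x_i^h)=x_{\sigma(i)}^h$. The $n$th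 differential codimension is $c_n^L(A)=\dim_F P_n^L/(P_n^L\cap \mathrm{Id}^L(A))$ and the $n$th differential cocharacter $\chi_n^L(A)$ is the $S_n$-character of this quotient. For $\lambda\vdash n$, $\chi_\lambda$ is the irreducible $S_n$-character associated to $\lambda$. *)

theory Defs
  imports
    "HOL-Analysis.Analysis"
    "HOL-Library.Poly_Mapping"
    "HOL-Computational_Algebra.Polynomial"
    "HOL-Combinatorics.Permutations"
begin

text \<open>
  Throughout, \<open>L = F\<epsilon>\<close> is the one-dimensional Lie algebra over \<open>F = 'a\<close>, and its universal
  enveloping algebra \<open>U(L)\<close> is the polynomial algebra \<open>'a poly\<close> in the variable \<open>\<epsilon>\<close>, with
  \<open>c\<epsilon> \<in> L\<close> embedded as \<open>[:0, c:]\<close>.  The following lemma is the universal property that identifies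
  it.  The bracket of \<open>L\<close> is zero, and a linear map \<open>f\<close> from \<open>L\<close> to an associative algebra
  automatically satisfies \<open>f x * f y - f y * f x = 0\<close>, so linear maps are the Lie maps here.
\<close>

abbreviation eps :: "'a::comm_ring_1 poly"
  where "eps \<equiv> [:0, 1:]"

lemma poly_is_universal_enveloping_algebra:
  fixes s :: "'a::field \<Rightarrow> 'b::ring_1 \<Rightarrow> 'b" and f :: "'a \<Rightarrow> 'b"
  assumes vs: "vector_space s"
    and sl: "\<And>c x y. s c x * y = s c (x * y)"
    and sr: "\<And>c x y. x * s c y = s c (x * y)"
    and f_add: "\<And>c d. f (c + d) = f c + f d"
    and f_scale: "\<And>c d. f (c * d) = s c (f d)"
  shows "\<exists>!\<phi>. (\<forall>p q. \<phi> (p + q) = \<phi> p + \<phi> q) \<and> (\<forall>c p. \<phi> (smult c p) = s c (\<phi> p))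
    \<and> \<phi> 1 = 1 \<and> (\<forall>p q. \<phi> (p * q) = \<phi> p * \<phi> q) \<and> (\<forall>c. \<phi> [:0, c:] = f c)"
proof -
  interpret vector_space s by (fact vs)
  define \<phi> where "\<phi> p = fold_coeffs (\<lambda>a x. s a 1 + f 1 * x) p 0" for p :: "'a poly"
  have \<phi>0: "\<phi> 0 = 0" by (simp add: \<phi>_def)
  have \<phi>_pCons: "\<phi> (pCons a p) = s a 1 + f 1 * \<phi> p" for a p
    by (cases "p = 0 \<and> a = 0") (auto simp: \<phi>_def)
  have add: "\<phi> (p + q) = \<phi> p + \<phi> q" for p q
    by (induction p q rule: poly_induct2)
      (simp_all add: \<phi>0 \<phi>_pCons scale_left_distrib distrib_left)
  have smult: "\<phi> (smult c p) = s c (\<phi> p)" for c p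
    by (induction p) (simp_all add: \<phi>0 \<phi>_pCons scale_right_distrib sr)
  have one: "\<phi> 1 = 1" by (simp add: one_pCons \<phi>_pCons \<phi>0)
  have mult: "\<phi> (p * q) = \<phi> p * \<phi> q" for p q
    by (induction p)
      (simp_all add: \<phi>0 \<phi>_pCons add smult distrib_right sl mult.assoc)
  have gen: "\<phi> [:0, c:] = f c" for c
    using f_scale[of c 1] by (simp add: \<phi>_pCons \<phi>0 sr)
  have uniq: "\<psi> = \<phi>"
    if "\<forall>p q. \<psi> (p + q) = \<psi> p + \<psi> q" and "\<forall>c p. \<psi> (smult c p) = s c (\<psi> p)"
      and "\<psi> 1 = 1" and "\<forall>p q. \<psi> (p * q) = \<psi> p * \<psi> q" and "\<forall>c. \<psi> [:0, c:] = f c" for \<psi>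
  proof
    fix p
    show "\<psi> p = \<phi> p"
    proof (induction p)
      case 0
      have "\<psi> (smult 0 0) = s 0 (\<psi> 0)" using that(2) by blast
      then show ?case by (simp add: \<phi>0)
    next
      case (pCons a p)
      have "pCons a p = smult a 1 + [:0, 1:] * p" by simp
      then have "\<psi> (pCons a p) = s a (\<psi> 1) + \<psi> [:0, 1:] * \<psi> p" using that by metis
      then show ?case using that pCons by (simp add: \<phi>_pCons)
    qed
  qed
  show ?thesis
    by (rule ex1I[of _ \<phi>]) (use add smult one mult gen uniq in auto)
qed


section \<open>Algebras with a derivation\<close>

text \<open>
  An \<open>L\<close>-algebra: the \<open>F\<close>-algebra on the set \<open>car\<close>, with \<open>c\<epsilon> \<in> L\<close> acting as \<open>c\<close> times the
  derivation \<open>der\<close>.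
\<close>

record ('a, 'm) l_alg =
  car :: "'m set"
  scl :: "'a \<Rightarrow> 'm \<Rightarrow> 'm"
  mul :: "'m \<Rightarrow> 'm \<Rightarrow> 'm"
  der :: "'m \<Rightarrow> 'm"

definition L_algebra :: "('a::field, 'm::ab_group_add) l_alg \<Rightarrow> bool" where
  "L_algebra A \<longleftrightarrow> vector_space (scl A) \<and> module.subspace (scl A) (car A)
    \<and> (\<forall>x\<in>car A. \<forall>y\<in>car A. mul A x y \<in> car A)
    \<and> (\<forall>x\<in>car A. \<forall>y\<in>car A. \<forall>z\<in>car A. mul A (mul A x y) z = mul A x (mul A y z)
          \<and> mul A (x + y) z = mul A x z + mul A y z \<and> mul A x (y + z) = mul A x y + mul A x z)
    \<and> (\<forall>c. \<forall>x\<in>car A. \<forall>y\<in>car A. mul A (scl A c x) y = scl A c (mul A x y)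
          \<and> mul A x (scl A c y) = scl A c (mul A x y))
    \<and> (\<forall>x\<in>car A. der A x \<in> car A)
    \<and> (\<forall>x\<in>car A. \<forall>y\<in>car A. der A (x + y) = der A x + der A y)
    \<and> (\<forall>c. \<forall>x\<in>car A. der A (scl A c x) = scl A c (der A x))
    \<and> (\<forall>x\<in>car A. \<forall>y\<in>car A. der A (mul A x y) = mul A (der A x) y + mul A x (der A y))"

definition uact :: "('a::field, 'm::ab_group_add) l_alg \<Rightarrow> 'a poly \<Rightarrow> 'm \<Rightarrow> 'm" where
  "uact A h v = (\<Sum>k\<le>degree h. scl A (coeff h k) ((der A ^^ k) v))"


section \<open>The free differential algebra\<close>

text \<open>Words form the free monoid, so \<open>'g list \<Rightarrow>\<^sub>0 'a\<close> is the free unital algebra on \<open>'g\<close>.\<close>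

instantiation list :: (type) monoid_add
begin

definition zero_list :: "'a list" where "zero_list = []"
definition plus_list :: "'a list \<Rightarrow> 'a list \<Rightarrow> 'a list" where "plus_list = (@)"

instance by standard (simp_all add: zero_list_def plus_list_def)

end

type_synonym 'a dpoly = "(nat \<times> 'a poly) list \<Rightarrow>\<^sub>0 'a"

definition pm_scale :: "'a::field \<Rightarrow> ('k \<Rightarrow>\<^sub>0 'a) \<Rightarrow> ('k \<Rightarrow>\<^sub>0 'a)" where
  "pm_scale c = Poly_Mapping.map ((*) c)"

definition lin_ext :: "('a::field \<Rightarrow> 'm \<Rightarrow> 'm) \<Rightarrow> ('k \<Rightarrow> 'm) \<Rightarrow> ('k \<Rightarrow>\<^sub>0 'a) \<Rightarrow> 'm::ab_group_add" where
  "lin_ext s \<phi> f = (\<Sum>k\<in>Poly_Mapping.keys f. s (Poly_Mapping.lookup f k) (\<phi> k))"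

abbreviation push :: "('k \<Rightarrow> 'l) \<Rightarrow> ('k \<Rightarrow>\<^sub>0 'a::field) \<Rightarrow> ('l \<Rightarrow>\<^sub>0 'a)" where
  "push \<phi> \<equiv> lin_ext pm_scale (\<lambda>k. Poly_Mapping.single (\<phi> k) 1)"

definition is_U_basis :: "'a::field poly set \<Rightarrow> bool" where
  "is_U_basis B \<longleftrightarrow> \<not> module.dependent smult B \<and> module.span smult B = UNIV"

text \<open>
  For a basis \<open>B\<close> of \<open>U(L)\<close>, the letter \<open>(j, b)\<close> with \<open>b \<in> B\<close> is the free generator
  \<open>x\<^sub>j\<^sub>+\<^sub>1\<^sup>b\<close> (variables are numbered from 0), and \<open>dvar B j h\<close> is its linear extension to all \<open>h \<in> U(L)\<close>.
\<close>

definition dvar :: "'a::field poly set \<Rightarrow> nat \<Rightarrow> 'a poly \<Rightarrow> 'a dpoly" where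
  "dvar B j h = (\<Sum>b | module.representation smult B h b \<noteq> 0.
      Poly_Mapping.single [(j, b)] (module.representation smult B h b))"

fun word_der :: "'a::field poly set \<Rightarrow> (nat \<times> 'a poly) list \<Rightarrow> 'a dpoly" where
  "word_der B [] = 0"
| "word_der B ((j, b) # w) = dvar B j (eps * b) * Poly_Mapping.single w 1
      + Poly_Mapping.single [(j, b)] 1 * word_der B w"

definition free_dalg :: "'a::field poly set \<Rightarrow> ('a, 'a dpoly) l_alg" where
  "free_dalg B =
    \<lparr> car = {f. \<forall>w\<in>Poly_Mapping.keys f. w \<noteq> [] \<and> snd ` set w \<subseteq> B},
      scl = pm_scale, mul = (*), der = lin_ext pm_scale (word_der B) \<rparr>"

text \<open>Products of nonempty lists; the algebras need not have a unit.\<close>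

fun prod_ne :: "('m \<Rightarrow> 'm \<Rightarrow> 'm) \<Rightarrow> 'm list \<Rightarrow> 'm" where
  "prod_ne m [] = undefined"
| "prod_ne m [x] = x"
| "prod_ne m (x # y # xs) = m x (prod_ne m (y # xs))"

text \<open>The substitution \<open>x\<^sub>j\<^sup>h \<mapsto> h(a j)\<close> with values in the \<open>L\<close>-algebra \<open>A\<close>.\<close>

definition dsubst :: "('a::field, 'm::ab_group_add) l_alg \<Rightarrow> (nat \<Rightarrow> 'm) \<Rightarrow> 'a dpoly \<Rightarrow> 'm" where
  "dsubst A a = lin_ext (scl A) (\<lambda>w. prod_ne (mul A) (map (\<lambda>(j, h). uact A h (a j)) w))"

definition Id_L :: "'a::field poly set \<Rightarrow> ('a, 'm::ab_group_add) l_alg \<Rightarrow> 'a dpoly set" where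
  "Id_L B A = {f \<in> car (free_dalg B). \<forall>a. (\<forall>j. a j \<in> car A) \<longrightarrow> dsubst A a f = 0}"

definition T_L_ideal :: "'a::field poly set \<Rightarrow> 'a dpoly set \<Rightarrow> bool" where
  "T_L_ideal B I \<longleftrightarrow> I \<subseteq> car (free_dalg B) \<and> module.subspace pm_scale I
    \<and> (\<forall>f\<in>I. \<forall>g\<in>car (free_dalg B). f * g \<in> I \<and> g * f \<in> I)
    \<and> (\<forall>f\<in>I. \<forall>h. uact (free_dalg B) h f \<in> I)
    \<and> (\<forall>f\<in>I. \<forall>g. (\<forall>j. g j \<in> car (free_dalg B)) \<longrightarrow> dsubst (free_dalg B) g f \<in> I)"

definition T_L_gen :: "'a::field poly set \<Rightarrow> 'a dpoly set \<Rightarrow> 'a dpoly set" where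
  "T_L_gen B S = \<Inter> {I. T_L_ideal B I \<and> S \<subseteq> I}"


section \<open>Dimension and trace on a quotient space\<close>

text \<open>
  \<open>C\<close> is mapped injectively onto a basis of \<open>V / W\<close>, for subspaces \<open>W \<subseteq> V\<close>.
\<close>

definition quot_basis :: "('a::field \<Rightarrow> 'v \<Rightarrow> 'v) \<Rightarrow> 'v set \<Rightarrow> 'v set \<Rightarrow> 'v::ab_group_add set \<Rightarrow> bool" where
  "quot_basis s V W C \<longleftrightarrow> C \<subseteq> V \<and> \<not> module.dependent s C \<and> module.span s C \<inter> W = {0}
    \<and> (\<forall>v\<in>V. \<exists>u\<in>module.span s C. v - u \<in> W)"

text \<open>For an infinite-dimensional quotient both values below are the default 0.\<close>

definition quot_dim :: "('a::field \<Rightarrow> 'v \<Rightarrow> 'v) \<Rightarrow> 'v set \<Rightarrow> 'v::ab_group_add set \<Rightarrow> nat" where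
  "quot_dim s V W = card (SOME C. quot_basis s V W C)"

definition quot_trace ::
    "('a::field \<Rightarrow> 'v \<Rightarrow> 'v) \<Rightarrow> 'v set \<Rightarrow> 'v::ab_group_add set \<Rightarrow> ('v \<Rightarrow> 'v) \<Rightarrow> 'a" where
  "quot_trace s V W f = (let C = (SOME C. quot_basis s V W C) in
      \<Sum>b\<in>C. module.representation s C (THE u. u \<in> module.span s C \<and> f b - u \<in> W) b)"


section \<open>Codimensions and cocharacters\<close>

definition P_L :: "'a::field poly set \<Rightarrow> nat \<Rightarrow> 'a dpoly set" where
  "P_L B n = module.span pm_scale
    {Poly_Mapping.single (map (\<lambda>i. (\<sigma> i, h i)) [0..<n]) 1 | \<sigma> h.
      \<sigma> permutes {..<n} \<and> (\<forall>i<n. h i \<in> B)}"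

definition codim_L :: "'a::field poly set \<Rightarrow> ('a, 'm::ab_group_add) l_alg \<Rightarrow> nat \<Rightarrow> nat" where
  "codim_L B A n = quot_dim pm_scale (P_L B n) (P_L B n \<inter> Id_L B A)"

text \<open>Characters are \<open>F\<close>-valued functions, to be evaluated at permutations of \<open>{..<n}\<close>.\<close>

definition cochar_L ::
    "'a::field poly set \<Rightarrow> ('a, 'm::ab_group_add) l_alg \<Rightarrow> nat \<Rightarrow> (nat \<Rightarrow> nat) \<Rightarrow> 'a" where
  "cochar_L B A n \<sigma> =
    quot_trace pm_scale (P_L B n) (P_L B n \<inter> Id_L B A) (push (map (\<lambda>(i, h). (\<sigma> i, h))))"

text \<open>
  A partition \<open>\<lambda>\<close> of \<open>n\<close> is a weakly decreasing list of positive numbers with sum \<open>n\<close>.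
  \<open>cell \<lambda> k\<close> is the (row, column) position of \<open>k < n\<close> in the tableau \<open>T\<^sub>\<lambda>\<close> filled row by row with
  \<open>0, \<dots>, n - 1\<close>; \<open>\<chi>\<^sub>\<lambda>\<close> is the character of the left ideal \<open>F S\<^sub>n e\<close> generated by
  the Young symmetrizer \<open>e\<close> of \<open>T\<^sub>\<lambda>\<close>.
\<close>

fun cell :: "nat list \<Rightarrow> nat \<Rightarrow> nat \<times> nat" where
  "cell [] k = (0, k)"
| "cell (l # ls) k = (if k < l then (0, k) else map_prod Suc id (cell ls (k - l)))"

definition row_stab :: "nat list \<Rightarrow> (nat \<Rightarrow> nat) set" where
  "row_stab la = {\<sigma>. \<sigma> permutes {..<sum_list la} \<and>
      (\<forall>k<sum_list la. fst (cell la (\<sigma> k)) = fst (cell la k))}"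

definition col_stab :: "nat list \<Rightarrow> (nat \<Rightarrow> nat) set" where
  "col_stab la = {\<tau>. \<tau> permutes {..<sum_list la} \<and>
      (\<forall>k<sum_list la. snd (cell la (\<tau> k)) = snd (cell la k))}"

definition young_sym :: "nat list \<Rightarrow> (nat \<Rightarrow> nat) \<Rightarrow>\<^sub>0 'a::field" where
  "young_sym la = (\<Sum>\<sigma>\<in>row_stab la. \<Sum>\<tau>\<in>col_stab la.
      Poly_Mapping.single (\<sigma> \<circ> \<tau>) (of_int (sign \<tau>)))"

definition irr_module :: "nat list \<Rightarrow> ((nat \<Rightarrow> nat) \<Rightarrow>\<^sub>0 'a::field) set" where
  "irr_module la = module.span pm_scale {push ((\<circ>) \<pi>) (young_sym la) | \<pi>. \<pi> permutes {..<sum_list la}}"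

definition irr_char :: "nat list \<Rightarrow> (nat \<Rightarrow> nat) \<Rightarrow> 'a::field" where
  "irr_char la \<sigma> = quot_trace pm_scale (irr_module la) {0} (push ((\<circ>) \<sigma>))"


section \<open>The algebras \<open>M\<^sub>1\<^sup>\<epsilon>\<close> and \<open>M\<^sub>2\<^sup>\<epsilon>\<close>\<close>

definition munit :: "2 \<Rightarrow> 2 \<Rightarrow> 'a::field ^ 2 ^ 2" where
  "munit i j = (\<chi> r s. if r = i \<and> s = j then 1 else 0)"

definition mat_scale :: "'a::field \<Rightarrow> 'a ^ 2 ^ 2 \<Rightarrow> 'a ^ 2 ^ 2" where
  "mat_scale c A = (\<chi> r s. c * A $ r $ s)"

definition eps_der :: "'a::field ^ 2 ^ 2 \<Rightarrow> 'a ^ 2 ^ 2" where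
  "eps_der A = mat_scale (A $ 1 $ 2) (munit 1 2)"

definition M1 :: "('a::field, 'a ^ 2 ^ 2) l_alg" where
  "M1 = \<lparr> car = {mat_scale \<alpha> (munit 2 2) + mat_scale \<beta> (munit 1 2) | \<alpha> \<beta>. True},
          scl = mat_scale, mul = (**), der = eps_der \<rparr>"

definition M2 :: "('a::field, 'a ^ 2 ^ 2) l_alg" where
  "M2 = \<lparr> car = {mat_scale \<alpha> (munit 1 1) + mat_scale \<beta> (munit 1 2) | \<alpha> \<beta>. True},
          scl = mat_scale, mul = (**), der = eps_der \<rparr>"

lemma eps_der_M1: "eps_der (mat_scale \<alpha> (munit 2 2) + mat_scale \<beta> (munit 1 2)) = mat_scale \<beta> (munit 1 2)"
  by (simp add: eps_der_def mat_scale_def munit_def vec_eq_iff)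

lemma eps_der_M2: "eps_der (mat_scale \<alpha> (munit 1 1) + mat_scale \<beta> (munit 1 2)) = mat_scale \<beta> (munit 1 2)"
  by (simp add: eps_der_def mat_scale_def munit_def vec_eq_iff)

lemma vector_space_mat_scale: "vector_space (mat_scale :: 'a::field \<Rightarrow> _)"
  by unfold_locales (simp_all add: mat_scale_def vec_eq_iff algebra_simps)

lemma car_M1: "car M1 = {A. A $ 1 $ 1 = 0 \<and> A $ 2 $ 1 = 0}"
  by (auto simp: M1_def mat_scale_def munit_def vec_eq_iff forall_2)

lemma car_M2: "car M2 = {A. A $ 2 $ 1 = 0 \<and> A $ 2 $ 2 = 0}"
  by (auto simp: M2_def mat_scale_def munit_def vec_eq_iff forall_2)

lemma L_algebra_M1: "L_algebra M1"
proof -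
  interpret vector_space "mat_scale :: 'a \<Rightarrow> _" by (fact vector_space_mat_scale)
  show ?thesis
    unfolding L_algebra_def car_M1
    by (auto simp: M1_def subspace_def vector_space_axioms eps_der_def mat_scale_def munit_def
        matrix_matrix_mult_def vec_eq_iff forall_2 sum_2 algebra_simps)
qed

lemma L_algebra_M2: "L_algebra M2"
proof -
  interpret vector_space "mat_scale :: 'a \<Rightarrow> _" by (fact vector_space_mat_scale)
  show ?thesis
    unfolding L_algebra_def car_M2
    by (auto simp: M2_def subspace_def vector_space_axioms eps_der_def mat_scale_def munit_def
        matrix_matrix_mult_def vec_eq_iff forall_2 sum_2 algebra_simps)
qed

end

theory Submission
  imports Defs
begin

text \<open>
  The derivation of \<open>M\<^sub>1\<close> kills \<open>e\<^sub>2\<^sub>2\<close> and fixes \<open>e\<^sub>1\<^sub>2\<close>, so a polynomial \<open>h\<close> in \<open>\<epsilon>\<close> acts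
  on \<open>\<alpha> e\<^sub>2\<^sub>2 + \<beta> e\<^sub>1\<^sub>2\<close> by \<open>h(0)\<close> on the first summand and by \<open>h(1)\<close> on the second.  Since
  \<open>e\<^sub>2\<^sub>2 e\<^sub>1\<^sub>2 = e\<^sub>1\<^sub>2 e\<^sub>1\<^sub>2 = 0\<close>, the summand \<open>e\<^sub>1\<^sub>2\<close> contributes to a product only through the first
  factor.  A word \<open>x\<^sub>j\<^sup>h x\<^sub>k\<^sup>g \<dots>\<close> therefore takes the value
  \<open>h(0) g(0) \<dots> \<alpha>\<^sub>j \<alpha>\<^sub>k \<dots> e\<^sub>2\<^sub>2 + h(1) g(0) \<dots> \<beta>\<^sub>j \<alpha>\<^sub>k \<dots> e\<^sub>1\<^sub>2\<close>, and only the following data of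
  the word matter: the two scalars, the multiset of its variables, its first variable and the
  multiset of the remaining ones (\<open>dsubst_M1_word\<close>).

  Identities.  The set of differential identities of any \<open>L\<close>-algebra is a \<open>T\<^sub>L\<close>-ideal
  (\<open>T_L_ideal_Id_L\<close>), and the three relations hold in \<open>M\<^sub>1\<close>; this is one inclusion.  For the
  other, let \<open>I\<close> be any \<open>T\<^sub>L\<close>-ideal containing the relations, and put \<open>q\<^sub>j = x\<^sub>j\<^sup>\<epsilon>\<close> and
  \<open>p\<^sub>j = x\<^sub>j - x\<^sub>j\<^sup>\<epsilon>\<close>.  Modulo \<open>I\<close> one has \<open>x\<^sub>j\<^sup>h = h(0) p\<^sub>j + h(1) q\<^sub>j\<close>, a product vanishes if a
  factor other than the first is some \<open>q\<^sub>j\<close>, and the \<open>p\<^sub>j\<close> commute.  So the above word is congruent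
  to \<open>h(0) g(0) \<dots> p\<^sub>j p\<^sub>k \<dots> + h(1) g(0) \<dots> q\<^sub>j p\<^sub>k \<dots>\<close> (\<open>word_reduce\<close>), which depends on exactly
  the data listed above.  If \<open>f\<close> is an identity, its values are polynomial functions of the \<open>\<alpha>\<close>
  and \<open>\<beta>\<close> which vanish identically; distinct monomial functions over a field of characteristic 0
  are linearly independent (\<open>monomial_functions_independent\<close>), so the total coefficient of every
  normal form in \<open>f\<close> is 0 and \<open>f \<in> I\<close> (\<open>coefficients_zero_imp_in_I\<close>).

  Passage to \<open>M\<^sub>2\<close>.  Reflection in the anti-diagonal is an anti-isomorphism from \<open>M\<^sub>1\<close> to \<open>M\<^sub>2\<close>
  that respects \<open>\<epsilon>\<close>.  Correspondingly, reversing words is an anti-automorphism of the free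
  differential algebra which preserves \<open>T\<^sub>L\<close>-ideals, exchanges the identities of \<open>M\<^sub>1\<close> and \<open>M\<^sub>2\<close>
  and carries one list of relations to the other (\<open>Id_L_M2_iff\<close>, \<open>T_L_gen_reverse\<close>).

  Codimensions and cocharacters.  On multilinear polynomials in \<open>n\<close> variables, being an identity
  of \<open>M\<^sub>1\<close> means the vanishing of \<open>n + 1\<close> linear functionals: the coefficient of the one monomial
  \<open>\<alpha>\<^sub>1 \<dots> \<alpha>\<^sub>n\<close> at \<open>e\<^sub>2\<^sub>2\<close>, and for each \<open>j\<close> that of \<open>\<beta>\<^sub>j\<close> times the other \<open>\<alpha>\<^sub>k\<close> at \<open>e\<^sub>1\<^sub>2\<close>
  (\<open>multilinear_Id_M1_iff\<close>).  They have a dual family, so the codimension is \<open>n + 1\<close>; the symmetric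
  group fixes the first functional and permutes the others, so the trace of \<open>\<sigma>\<close> is one plus the
  number of its fixed points (\<open>cochar_M1_M2\<close>).  On the other side, the Young symmetrizer of \<open>(n)\<close>
  spans the trivial representation, and that of \<open>(n - 1, 1)\<close> generates the span of \<open>n\<close> vectors
  with sum 0 which are permuted by the group; its character is the number of fixed points
  minus one (\<open>irr_char_hook\<close>).
\<close>


section \<open>Coordinates on a quotient space\<close>

lemma (in vector_space) quot_basis_representative:
  assumes "quot_basis scale V W C" "subspace W" "v \<in> V"
  shows "\<exists>!u. u \<in> span C \<and> v - u \<in> W"
proof -
  from assms obtain u where u: "u \<in> span C" "v - u \<in> W"
    unfolding quot_basis_def by blast
  moreover have "u' = u" if "u' \<in> span C" "v - u' \<in> W" for u'
  proof -
    have "(v - u) - (v - u') \<in> W" using assms(2) u(2) that(2) by (rule subspace_diff)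
    then have "u' - u \<in> span C \<inter> W" using u(1) that(1) span_diff by simp
    then have "u' - u = 0" using assms(1) unfolding quot_basis_def by blast
    then show ?thesis by simp
  qed
  ultimately show ?thesis by blast
qed

text \<open>
  Linear functionals \<open>\<phi> j\<close> that cut out \<open>W\<close> inside \<open>V\<close>, together with dual vectors \<open>b j\<close>,
  identify \<open>V / W\<close> with \<open>F\<^sup>J\<close>.  They give access to \<open>quot_dim\<close> and \<open>quot_trace\<close>, which are
  defined through an unknown, arbitrarily chosen basis.
\<close>

locale quotient_coordinates = vector_space scale
  for scale :: "'a::field \<Rightarrow> 'v::ab_group_add \<Rightarrow> 'v" +
  fixes V W :: "'v set" and J :: "'j set" and \<phi> :: "'j \<Rightarrow> 'v \<Rightarrow> 'a" and b :: "'j \<Rightarrow> 'v"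
  assumes subspace_V: "subspace V" and subspace_W: "subspace W" and finite_J: "finite J"
    and linear_coord: "j \<in> J \<Longrightarrow> Vector_Spaces.linear scale (*) (\<phi> j)"
    and b_in_V: "j \<in> J \<Longrightarrow> b j \<in> V"
    and dual: "i \<in> J \<Longrightarrow> j \<in> J \<Longrightarrow> \<phi> i (b j) = (if i = j then 1 else 0)"
    and in_W_iff: "v \<in> V \<Longrightarrow> v \<in> W \<longleftrightarrow> (\<forall>j\<in>J. \<phi> j v = 0)"
    and W_subset_V: "W \<subseteq> V"
begin

sublocale field_pair: vector_space_pair scale "(*) :: 'a \<Rightarrow> 'a \<Rightarrow> 'a"
  by unfold_locales (simp_all add: algebra_simps)

lemmas coord_simps = field_pair.linear_add[OF linear_coord] field_pair.linear_diff[OF linear_coord]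
  field_pair.linear_scale[OF linear_coord] field_pair.linear_sum[OF linear_coord]
  field_pair.linear_0[OF linear_coord]

lemma coord_sum_b: "i \<in> J \<Longrightarrow> \<phi> i (\<Sum>j\<in>J. scale (c j) (b j)) = c i"
  by (simp add: coord_simps dual finite_J if_distrib cong: if_cong)

lemma diff_proj_in_W: "v \<in> V \<Longrightarrow> v - (\<Sum>j\<in>J. scale (\<phi> j v) (b j)) \<in> W"
  by (subst in_W_iff)
    (auto intro!: subspace_diff subspace_sum subspace_scale subspace_V b_in_V
      simp: coord_simps(2) coord_sum_b)

lemma inj_b: "inj_on b J"
proof (rule inj_onI)
  fix i j assume "i \<in> J" "j \<in> J" "b i = b j"
  then have "\<phi> i (b j) = 1" using dual[of i i] by simp
  then show "i = j" using dual \<open>i \<in> J\<close> \<open>j \<in> J\<close> by (metis zero_neq_one)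
qed

lemma span_b: "span (b ` J) = {\<Sum>j\<in>J. scale (c j) (b j) | c. True}"
proof -
  have "(\<Sum>x\<in>b ` J. scale (u x) x) = (\<Sum>j\<in>J. scale (u (b j)) (b j))" for u
    by (rule sum.reindex_cong[OF inj_b refl refl])
  moreover have "\<exists>u. (\<Sum>j\<in>J. scale (c j) (b j)) = (\<Sum>j\<in>J. scale (u (b j)) (b j))" for c
    by (rule exI[of _ "\<lambda>x. c (the_inv_into J b x)"]) (simp add: the_inv_into_f_f[OF inj_b])
  ultimately show ?thesis
    using finite_J by (auto simp: span_finite image_def)
qed

lemma independent_b: "independent (b ` J)"
proof (rule independent_if_scalars_zero)
  show "finite (b ` J)" using finite_J by simp
  fix f x
  assume 0: "(\<Sum>x\<in>b ` J. scale (f x) x) = 0" and "x \<in> b ` J"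
  then obtain i where i: "i \<in> J" "x = b i" by blast
  have "(\<Sum>j\<in>J. scale (f (b j)) (b j)) = 0"
    using 0 by (simp add: sum.reindex[OF inj_b])
  then have "\<phi> i (\<Sum>j\<in>J. scale (f (b j)) (b j)) = 0" using i(1) by (simp add: coord_simps)
  then show "f x = 0" using i by (simp add: coord_sum_b)
qed

lemma quot_basis_b: "quot_basis scale V W (b ` J)"
  unfolding quot_basis_def
proof (intro conjI ballI)
  show "b ` J \<subseteq> V" using b_in_V by blast
  show "independent (b ` J)" by (fact independent_b)
  show "span (b ` J) \<inter> W = {0}"
  proof -
    have "v = 0" if "v \<in> span (b ` J)" "v \<in> W" for v
    proof -
      from that(1) obtain c where v: "v = (\<Sum>j\<in>J. scale (c j) (b j))" by (auto simp: span_b)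
      have "c i = 0" if "i \<in> J" for i
        using in_W_iff[of v] \<open>v \<in> W\<close> W_subset_V that coord_sum_b[OF that, of c] v by auto
      then show ?thesis by (simp add: v)
    qed
    then show ?thesis using span_zero subspace_0[OF subspace_W] by blast
  qed
  show "\<exists>u\<in>span (b ` J). v - u \<in> W" if "v \<in> V" for v
    using diff_proj_in_W[OF that] by (auto simp: span_b)
qed

text \<open>
  The projection \<open>v \<mapsto> \<Sum>\<^sub>j \<phi> j v \<cdot> b j\<close> along \<open>W\<close> maps the span of any quotient basis \<open>C\<close> onto
  the span of the \<open>b j\<close>, and injectively because the span of \<open>C\<close> meets \<open>W\<close> trivially.
\<close>

lemma card_quot_basis:
  assumes C: "quot_basis scale V W C"
  shows "finite C" "card C = card J"
proof -
  define \<pi> where "\<pi> v = (\<Sum>j\<in>J. scale (\<phi> j v) (b j))" for v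
  interpret endo: vector_space_pair scale scale by unfold_locales
  have lin: "Vector_Spaces.linear scale scale \<pi>"
    unfolding Vector_Spaces.linear_iff \<pi>_def
    using vector_space_axioms
    by (simp add: coord_simps scale_left_distrib sum.distrib scale_sum_right cong: sum.cong)
  have CV: "span C \<subseteq> V"
    using C subspace_V by (simp add: quot_basis_def span_minimal)
  have ker: "v = 0" if "v \<in> span C" "\<pi> v = 0" for v
  proof -
    have "v \<in> W" using diff_proj_in_W[of v] that CV by (auto simp: \<pi>_def)
    then show ?thesis using C that by (auto simp: quot_basis_def)
  qed
  have inj: "inj_on \<pi> (span C)"
    using endo.linear_inj_on_iff_eq_0[OF lin subspace_span] ker by blast
  have ind: "independent (\<pi> ` C)"
    using endo.linear_independent_injective_image[OF lin _ inj] C by (simp add: quot_basis_def)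
  have sub: "\<pi> ` C \<subseteq> span (b ` J)" by (auto simp: span_b \<pi>_def)
  have "b j \<in> span (\<pi> ` C)" if "j \<in> J" for j
  proof -
    from C b_in_V[OF that] obtain u where u: "u \<in> span C" "b j - u \<in> W"
      by (auto simp: quot_basis_def)
    have "\<phi> i u = \<phi> i (b j)" if "i \<in> J" for i
      using u(2) that in_W_iff[of "b j - u"] W_subset_V by (auto simp: coord_simps)
    then have "\<pi> u = (\<Sum>i\<in>J. scale (\<phi> i (b j)) (b i))" by (simp add: \<pi>_def)
    also have "\<dots> = (\<Sum>i\<in>J. if i = j then b i else 0)"
      by (rule sum.cong) (use that dual in auto)
    also have "\<dots> = b j" using finite_J that by simp
    finally show ?thesis
      using u(1) endo.linear_span_image[OF lin, of C] by force
  qed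
  then have "span (\<pi> ` C) = span (b ` J)"
    using sub by (subst span_eq) auto
  moreover have fin: "finite (\<pi> ` C)" "card (\<pi> ` C) \<le> card (b ` J)"
    using independent_span_bound[OF _ ind sub] finite_J by auto
  ultimately have "card (\<pi> ` C) = card (b ` J)"
    using dim_span_eq_card_independent[OF ind] dim_span_eq_card_independent[OF independent_b] by simp
  moreover have inj': "inj_on \<pi> C" using inj span_superset inj_on_subset by blast
  ultimately show "card C = card J"
    by (simp add: card_image inj_b)
  show "finite C" using fin(1) inj' by (simp add: finite_image_iff)
qed

theorem quot_dim_eq: "quot_dim scale V W = card J"
  unfolding quot_dim_def by (rule card_quot_basis(2)) (rule someI_ex, rule exI, rule quot_basis_b)

text \<open>
  Let \<open>r v c\<close> be the coordinates of \<open>v\<close> modulo \<open>W\<close> with respect to the chosen basis \<open>C\<close>.  They are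
  determined by those of the \<open>b j\<close>, so the trace is \<open>\<Sum>\<^sub>c \<Sum>\<^sub>j \<phi> j (f c) \<cdot> r (b j) c\<close>.  Summing over \<open>c\<close>
  first reassembles \<open>b j\<close> modulo \<open>W\<close>: this is the argument behind \<open>tr(XY) = tr(YX)\<close>.
\<close>

theorem quot_trace_eq:
  assumes lin: "Vector_Spaces.linear scale scale f"
    and fV: "\<And>v. v \<in> V \<Longrightarrow> f v \<in> V" and fW: "\<And>v. v \<in> W \<Longrightarrow> f v \<in> W"
  shows "quot_trace scale V W f = (\<Sum>j\<in>J. \<phi> j (f (b j)))"
proof -
  interpret endo: vector_space_pair scale scale by unfold_locales
  define C where "C = (SOME C. quot_basis scale V W C)"
  have C: "quot_basis scale V W C" unfolding C_def by (rule someI_ex) (rule exI, rule quot_basis_b)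
  note fin = card_quot_basis(1)[OF C]
  have ind: "independent C" and CV: "C \<subseteq> V" using C by (auto simp: quot_basis_def)
  define u where "u v = (THE u. u \<in> span C \<and> v - u \<in> W)" for v
  note ex1 = quot_basis_representative[OF C subspace_W]
  have u: "u v \<in> span C \<and> v - u v \<in> W" if "v \<in> V" for v
    unfolding u_def by (rule theI'[OF ex1[OF that]])
  have u_eq: "u v = w" if "v \<in> V" "w \<in> span C" "v - w \<in> W" for v w
    unfolding u_def using ex1[OF that(1)] that by (intro the1_equality) auto
  define r where "r v = representation C (u v)" for v
  have r_b: "r v c = (\<Sum>j\<in>J. \<phi> j v * r (b j) c)" if v: "v \<in> V" for v c
  proof -
    have "u v = (\<Sum>j\<in>J. scale (\<phi> j v) (u (b j)))"
    proof (rule u_eq[OF v])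
      show "(\<Sum>j\<in>J. scale (\<phi> j v) (u (b j))) \<in> span C"
        by (intro span_sum span_scale) (use u b_in_V in auto)
      have "v - (\<Sum>j\<in>J. scale (\<phi> j v) (u (b j))) =
          (v - (\<Sum>j\<in>J. scale (\<phi> j v) (b j))) + (\<Sum>j\<in>J. scale (\<phi> j v) (b j - u (b j)))"
        by (simp add: scale_right_diff_distrib sum_subtractf)
      also have "\<dots> \<in> W"
        by (intro subspace_add subspace_sum subspace_scale subspace_W diff_proj_in_W v)
          (use u b_in_V in auto)
      finally show "v - (\<Sum>j\<in>J. scale (\<phi> j v) (u (b j))) \<in> W" .
    qed
    then have "r v = (\<lambda>c. \<Sum>j\<in>J. representation C (scale (\<phi> j v) (u (b j))) c)"
      unfolding r_def using representation_sum[OF ind, of J "\<lambda>j. scale (\<phi> j v) (u (b j))"] u b_in_V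
      by (simp add: span_scale)
    then show ?thesis
      using representation_scale[OF ind] u b_in_V by (simp add: r_def)
  qed
  have u_sum: "u (b j) = (\<Sum>c\<in>C. scale (r (b j) c) c)" if "j \<in> J" for j
    unfolding r_def using sum_representation_eq[OF ind _ fin] u b_in_V[OF that] by simp
  have "quot_trace scale V W f = (\<Sum>c\<in>C. r (f c) c)"
    by (simp add: quot_trace_def C_def[symmetric] r_def u_def)
  also have "\<dots> = (\<Sum>c\<in>C. \<Sum>j\<in>J. \<phi> j (f c) * r (b j) c)"
    using r_b fV CV by (intro sum.cong) auto
  also have "\<dots> = (\<Sum>j\<in>J. \<Sum>c\<in>C. r (b j) c * \<phi> j (f c))"
    by (subst sum.swap) (simp add: mult.commute)
  also have "\<dots> = (\<Sum>j\<in>J. \<phi> j (f (u (b j))))"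
    by (intro sum.cong refl)
      (simp add: u_sum endo.linear_sum[OF lin] endo.linear_scale[OF lin] coord_simps)
  also have "\<dots> = (\<Sum>j\<in>J. \<phi> j (f (b j)))"
  proof (intro sum.cong refl)
    fix j assume j: "j \<in> J"
    have "f (b j - u (b j)) \<in> W" using u b_in_V[OF j] fW by blast
    then have "\<phi> j (f (b j - u (b j))) = 0" using in_W_iff W_subset_V j by blast
    then show "\<phi> j (f (u (b j))) = \<phi> j (f (b j))"
      using j by (simp add: endo.linear_diff[OF lin] coord_simps)
  qed
  finally show ?thesis .
qed

end

section \<open>Linear extension of functions on monomials\<close>

interpretation uea: vector_space "smult :: 'a::field \<Rightarrow> 'a poly \<Rightarrow> 'a poly"
  by unfold_locales (simp_all add: smult_add_right smult_add_left)

abbreviation word :: "'g list \<Rightarrow> 'g list \<Rightarrow>\<^sub>0 'a::field"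
  where "word w \<equiv> Poly_Mapping.single w 1"

lemma lookup_pm_scale [simp]: "Poly_Mapping.lookup (pm_scale c f) k = c * Poly_Mapping.lookup f k"
  unfolding pm_scale_def by (simp add: Poly_Mapping.map.rep_eq when_def)

interpretation pm: vector_space "pm_scale :: 'a::field \<Rightarrow> ('k \<Rightarrow>\<^sub>0 'a) \<Rightarrow> 'k \<Rightarrow>\<^sub>0 'a"
  by unfold_locales (auto intro!: poly_mapping_eqI simp: lookup_add algebra_simps)

lemma pm_scale_single [simp]:
  "pm_scale c (Poly_Mapping.single k d) = Poly_Mapping.single k (c * d)"
  by (rule poly_mapping_eqI) (simp add: lookup_single when_def)

lemma vector_space_mult: "vector_space ((*) :: 'a::field \<Rightarrow> 'a \<Rightarrow> 'a)"
  by unfold_locales (simp_all add: algebra_simps)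

lemma linear_lookup: "Vector_Spaces.linear pm_scale (*) (\<lambda>f. Poly_Mapping.lookup f k)"
  by (simp add: Vector_Spaces.linear_iff lookup_add pm.vector_space_axioms vector_space_mult)

lemma poly_mapping_expand:
  assumes "finite S" "Poly_Mapping.keys f \<subseteq> S"
  shows "f = (\<Sum>k\<in>S. Poly_Mapping.single k (Poly_Mapping.lookup f k))"
proof (rule poly_mapping_eqI)
  fix k
  have "(\<Sum>x\<in>S. Poly_Mapping.lookup f x when x = k) = (if k \<in> S then Poly_Mapping.lookup f k else 0)"
    using assms(1) by (simp add: when_def)
  also have "\<dots> = Poly_Mapping.lookup f k"
    using assms(2) by (auto simp: in_keys_iff)
  finally show "Poly_Mapping.lookup f k
      = Poly_Mapping.lookup (\<Sum>k\<in>S. Poly_Mapping.single k (Poly_Mapping.lookup f k)) k"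
    by (simp add: lookup_sum lookup_single)
qed

text \<open>
  Carriers of the free algebra and spaces of multilinear polynomials are both of this form: as spans
  they are subspaces, and membership in them is a condition on the single words of the support.
\<close>

lemma supported_eq_span:
  "{f :: 'k \<Rightarrow>\<^sub>0 'a::field. Poly_Mapping.keys f \<subseteq> K} = pm.span ((\<lambda>k. Poly_Mapping.single k 1) ` K)"
proof (intro equalityI subsetI)
  fix f :: "'k \<Rightarrow>\<^sub>0 'a" assume "f \<in> {f. Poly_Mapping.keys f \<subseteq> K}"
  then have "(\<Sum>k\<in>Poly_Mapping.keys f. pm_scale (Poly_Mapping.lookup f k) (Poly_Mapping.single k 1))
      \<in> pm.span ((\<lambda>k. Poly_Mapping.single k 1) ` K)"
    by (intro pm.span_sum pm.span_scale pm.span_base) auto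
  then show "f \<in> pm.span ((\<lambda>k. Poly_Mapping.single k 1) ` K)"
    using poly_mapping_expand[of "Poly_Mapping.keys f" f] by simp
next
  fix f :: "'k \<Rightarrow>\<^sub>0 'a" assume "f \<in> pm.span ((\<lambda>k. Poly_Mapping.single k 1) ` K)"
  then show "f \<in> {f. Poly_Mapping.keys f \<subseteq> K}"
    by (induction rule: pm.span_induct_alt)
      (auto simp: in_keys_iff lookup_add lookup_single when_def split: if_splits)
qed

lemma poly_mapping_support_induct [consumes 1, case_names zero add]:
  fixes f :: "'k \<Rightarrow>\<^sub>0 'a::field"
  assumes "Poly_Mapping.keys f \<subseteq> K" and "P 0"
    and "\<And>k c f. k \<in> K \<Longrightarrow> Poly_Mapping.keys f \<subseteq> K \<Longrightarrow> P f \<Longrightarrow> P (pm_scale c (Poly_Mapping.single k 1) + f)"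
  shows "P f"
proof -
  have "f \<in> pm.span ((\<lambda>k. Poly_Mapping.single k 1) ` K)"
    using assms(1) unfolding supported_eq_span[symmetric] by simp
  then have "Poly_Mapping.keys f \<subseteq> K \<and> P f"
  proof (induction rule: pm.span_induct_alt)
    case base
    show ?case by (simp add: assms(2))
  next
    case (step c x y)
    then obtain k where k: "k \<in> K" "x = Poly_Mapping.single k 1" by blast
    have "Poly_Mapping.keys (pm_scale c x + y) \<subseteq> K"
      using step k by (auto simp: in_keys_iff lookup_add lookup_single when_def split: if_splits)
    then show ?case using step k assms(3) by blast
  qed
  then show ?thesis ..
qed

lemma lin_ext_eq_sum:
  assumes "vector_space s" "finite S" "Poly_Mapping.keys f \<subseteq> S"
  shows "lin_ext s \<phi> f = (\<Sum>k\<in>S. s (Poly_Mapping.lookup f k) (\<phi> k))"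
proof -
  interpret vector_space s by fact
  show ?thesis
    unfolding lin_ext_def using assms(2,3)
    by (intro sum.mono_neutral_left) (auto simp: in_keys_iff)
qed

lemma linear_lin_ext:
  assumes "vector_space s"
  shows "Vector_Spaces.linear pm_scale s (lin_ext s \<phi>)"
proof -
  interpret vector_space s by fact
  have "lin_ext s \<phi> (f + g) = lin_ext s \<phi> f + lin_ext s \<phi> g" for f g
    using keys_add[of f g]
    by (simp add: lin_ext_eq_sum[OF assms, of "Poly_Mapping.keys f \<union> Poly_Mapping.keys g"]
        lookup_add scale_left_distrib sum.distrib)
  moreover have "lin_ext s \<phi> (pm_scale c f) = s c (lin_ext s \<phi> f)" for c f
  proof -
    have "Poly_Mapping.keys (pm_scale c f) \<subseteq> Poly_Mapping.keys f"
      by (auto simp: in_keys_iff)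
    then have "lin_ext s \<phi> (pm_scale c f)
        = (\<Sum>k\<in>Poly_Mapping.keys f. s (c * Poly_Mapping.lookup f k) (\<phi> k))"
      using lin_ext_eq_sum[OF assms finite_keys, of "pm_scale c f" f \<phi>] by simp
    then show ?thesis by (simp add: lin_ext_def scale_sum_right)
  qed
  ultimately show ?thesis
    using assms by (simp add: Vector_Spaces.linear_iff pm.vector_space_axioms)
qed

lemma lin_ext_single [simp]:
  assumes "vector_space s"
  shows "lin_ext s \<phi> (Poly_Mapping.single k c) = s c (\<phi> k)"
  using lin_ext_eq_sum[OF assms, of "{k}" "Poly_Mapping.single k c" \<phi>] by simp

lemma linear_eq_on_keys:
  assumes "Vector_Spaces.linear pm_scale s F" "Vector_Spaces.linear pm_scale s G"
    and "\<And>k. k \<in> Poly_Mapping.keys f \<Longrightarrow> F (Poly_Mapping.single k 1) = G (Poly_Mapping.single k 1)"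
  shows "F f = G f"
proof -
  interpret F: Vector_Spaces.linear pm_scale s F by fact
  interpret G: Vector_Spaces.linear pm_scale s G by fact
  have "Poly_Mapping.keys f \<subseteq> Poly_Mapping.keys f" by simp
  then show ?thesis
    by (induction f rule: poly_mapping_support_induct) (simp_all only: F.zero G.zero F.add G.add F.scale G.scale assms(3))
qed

lemma linear_in_subspace:
  assumes "Vector_Spaces.linear pm_scale s F" "module.subspace s V"
    and "\<And>k. k \<in> Poly_Mapping.keys f \<Longrightarrow> F (Poly_Mapping.single k 1) \<in> V"
  shows "F f \<in> V"
proof -
  interpret F: Vector_Spaces.linear pm_scale s F by fact
  have "Poly_Mapping.keys f \<subseteq> Poly_Mapping.keys f" by simp
  then show ?thesis
    by (induction f rule: poly_mapping_support_induct)
      (simp_all only: F.zero F.add F.scale assms(3)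
        F.vs2.subspace_0[OF assms(2)] F.vs2.subspace_add[OF assms(2)] F.vs2.subspace_scale[OF assms(2)])
qed

lemma linear_push: "Vector_Spaces.linear pm_scale pm_scale (push \<phi>)"
  by (rule linear_lin_ext) (rule pm.vector_space_axioms)

lemma push_single: "push \<phi> (Poly_Mapping.single k c) = Poly_Mapping.single (\<phi> k) c"
  by (simp add: lin_ext_single[OF pm.vector_space_axioms])

lemma keys_push: "Poly_Mapping.keys (push \<phi> f) \<subseteq> \<phi> ` Poly_Mapping.keys f"
proof -
  have "push \<phi> f \<in> pm.span ((\<lambda>k. Poly_Mapping.single k 1) ` (\<phi> ` Poly_Mapping.keys f))"
    by (rule linear_in_subspace[OF linear_push pm.subspace_span])
      (unfold push_single, intro pm.span_base imageI)
  then show ?thesis unfolding supported_eq_span[symmetric] by simp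
qed

lemma pm_scale_mult:
  fixes f g :: "'k::monoid_add \<Rightarrow>\<^sub>0 'a::field"
  shows "pm_scale c f * g = pm_scale c (f * g)" "f * pm_scale c g = pm_scale c (f * g)"
proof -
  show "pm_scale c f * g = pm_scale c (f * g)"
    unfolding pm_scale_def mult_map_scale_conv_mult by (rule mult.assoc)
  have "f * Poly_Mapping.single 0 c = Poly_Mapping.single 0 c * f"
  proof -
    have "Poly_Mapping.keys f \<subseteq> UNIV" by simp
    then show ?thesis
      by (induction f rule: poly_mapping_support_induct)
        (simp_all add: distrib_left distrib_right mult_single mult.commute)
  qed
  then show "f * pm_scale c g = pm_scale c (f * g)"
    unfolding pm_scale_def mult_map_scale_conv_mult by (metis mult.assoc)
qed

lemma word_mult: "word v * word w = word (v @ w)"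
  by (simp add: mult_single plus_list_def)

lemma word_Nil: "word [] = 1"
  by (metis single_one zero_list_def)


section \<open>Algebras with a derivation\<close>

locale l_algebra =
  fixes A :: "('a::field, 'm::ab_group_add) l_alg"
  assumes L_algebra: "L_algebra A"
begin

sublocale vs: vector_space "scl A"
  using L_algebra by (simp add: L_algebra_def)

lemma subspace_car: "vs.subspace (car A)"
  using L_algebra by (simp add: L_algebra_def)

lemmas car_0 = vs.subspace_0[OF subspace_car]
  and car_add = vs.subspace_add[OF subspace_car]
  and car_scl = vs.subspace_scale[OF subspace_car]
  and car_sum = vs.subspace_sum[OF subspace_car]

lemma
  assumes "x \<in> car A" "y \<in> car A"
  shows mul_in: "mul A x y \<in> car A"
    and mul_assoc: "z \<in> car A \<Longrightarrow> mul A (mul A x y) z = mul A x (mul A y z)"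
    and mul_add_left: "z \<in> car A \<Longrightarrow> mul A (x + y) z = mul A x z + mul A y z"
    and mul_add_right: "z \<in> car A \<Longrightarrow> mul A z (x + y) = mul A z x + mul A z y"
    and mul_scl_left: "mul A (scl A c x) y = scl A c (mul A x y)"
    and mul_scl_right: "mul A x (scl A c y) = scl A c (mul A x y)"
    and der_add: "der A (x + y) = der A x + der A y"
    and der_mul: "der A (mul A x y) = mul A (der A x) y + mul A x (der A y)"
  using L_algebra assms unfolding L_algebra_def by blast+

lemma
  assumes "x \<in> car A"
  shows der_in: "der A x \<in> car A"
    and der_scl: "der A (scl A c x) = scl A c (der A x)"
    and mul_0_left: "mul A 0 x = 0" and mul_0_right: "mul A x 0 = 0"
proof -
  show "der A x \<in> car A" "der A (scl A c x) = scl A c (der A x)"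
    using L_algebra assms unfolding L_algebra_def by blast+
  show "mul A 0 x = 0" "mul A x 0 = 0"
    using mul_scl_left[OF car_0 assms, of 0] mul_scl_right[OF assms car_0, of 0] by simp_all
qed

lemma der_0: "der A 0 = 0"
  using der_scl[OF car_0, of 0] by simp

lemma der_sum: "(\<And>i. i \<in> I \<Longrightarrow> g i \<in> car A) \<Longrightarrow> der A (sum g I) = (\<Sum>i\<in>I. der A (g i))"
  by (induction I rule: infinite_finite_induct) (simp_all add: der_0 der_add car_sum)

lemma der_funpow_in: "x \<in> car A \<Longrightarrow> (der A ^^ k) x \<in> car A"
  by (induction k) (simp_all add: der_in)

lemma uact_eq_sum:
  assumes "degree h \<le> n"
  shows "uact A h v = (\<Sum>k\<le>n. scl A (coeff h k) ((der A ^^ k) v))"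
  unfolding uact_def using assms by (intro sum.mono_neutral_left) (auto simp: coeff_eq_0)

lemma uact_add: "uact A (g + h) v = uact A g v + uact A h v"
  using degree_add_le_max[of g h]
  by (simp add: uact_eq_sum[of _ "max (degree g) (degree h)"] vs.scale_left_distrib sum.distrib)

lemma uact_smult: "uact A (smult c h) v = scl A c (uact A h v)"
  using degree_smult_le[of c h]
  by (simp add: uact_eq_sum[of _ "degree h"] vs.scale_sum_right)

lemma uact_0: "uact A 0 v = 0"
  by (simp add: uact_def)

lemma uact_in: "v \<in> car A \<Longrightarrow> uact A h v \<in> car A"
  unfolding uact_def by (intro car_sum car_scl der_funpow_in)

lemma uact_pCons:
  assumes "v \<in> car A"
  shows "uact A (pCons c h) v = scl A c v + der A (uact A h v)"
proof -
  have "uact A (pCons c h) v = (\<Sum>k\<le>Suc (degree h). scl A (coeff (pCons c h) k) ((der A ^^ k) v))"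
    by (rule uact_eq_sum) (simp add: degree_pCons_le)
  also have "\<dots> = scl A c v + (\<Sum>k\<le>degree h. der A (scl A (coeff h k) ((der A ^^ k) v)))"
    unfolding sum.atMost_Suc_shift by (simp add: der_scl der_funpow_in assms)
  also have "\<dots> = scl A c v + der A (uact A h v)"
    unfolding uact_def by (subst der_sum) (simp_all add: car_scl der_funpow_in assms)
  finally show ?thesis .
qed

lemma uact_1: "uact A 1 v = v"
  by (simp add: uact_def)

lemma uact_eps: "v \<in> car A \<Longrightarrow> uact A eps v = der A v"
  by (simp add: uact_pCons uact_0 der_0)

lemma uact_eps_mult: "v \<in> car A \<Longrightarrow> uact A (eps * h) v = der A (uact A h v)"
  by (simp add: uact_pCons)

lemma uact_zero_right: "uact A h 0 = 0"
  by (induction h) (simp_all add: uact_0 uact_pCons car_0 der_0)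

lemma linear_uact: "Vector_Spaces.linear smult (scl A) (\<lambda>h. uact A h v)"
  by (simp add: Vector_Spaces.linear_iff uact_add uact_smult vs.vector_space_axioms
      uea.vector_space_axioms)

lemma prod_ne_in: "xs \<noteq> [] \<Longrightarrow> set xs \<subseteq> car A \<Longrightarrow> prod_ne (mul A) xs \<in> car A"
proof (induction xs rule: list_nonempty_induct)
  case (single x)
  then show ?case by simp
next
  case (cons x xs)
  then show ?case by (cases xs) (auto simp: mul_in)
qed

lemma prod_ne_append:
  assumes "xs \<noteq> []" "ys \<noteq> []" "set xs \<subseteq> car A" "set ys \<subseteq> car A"
  shows "prod_ne (mul A) (xs @ ys) = mul A (prod_ne (mul A) xs) (prod_ne (mul A) ys)"
  using assms
proof (induction xs rule: list_nonempty_induct)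
  case (single x)
  then show ?case by (cases ys) auto
next
  case (cons x xs)
  then obtain z zs where "xs = z # zs" by (cases xs) auto
  then show ?case using cons by (simp add: mul_assoc prod_ne_in del: prod_ne.simps(1))
qed

end

lemma prod_ne_hom:
  assumes "xs \<noteq> []" "set xs \<subseteq> S" "\<And>x y. x \<in> S \<Longrightarrow> y \<in> S \<Longrightarrow> m x y \<in> S"
    "\<And>x y. x \<in> S \<Longrightarrow> y \<in> S \<Longrightarrow> F (m x y) = m' (F x) (F y)"
  shows "prod_ne m xs \<in> S \<and> F (prod_ne m xs) = prod_ne m' (map F xs)"
  using assms(1,2)
proof (induction xs rule: list_nonempty_induct)
  case (single x)
  then show ?case by simp
next
  case (cons x xs)
  then obtain z zs where "xs = z # zs" by (cases xs) auto
  then show ?case using cons assms(3,4) by simp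
qed

section \<open>The free differential algebra\<close>

definition words :: "'a::field poly set \<Rightarrow> (nat \<times> 'a poly) list set" where
  "words B = {w. w \<noteq> [] \<and> snd ` set w \<subseteq> B}"

lemma car_free: "car (free_dalg B) = {f. Poly_Mapping.keys f \<subseteq> words B}"
  by (auto simp: free_dalg_def words_def)

lemma scl_free: "scl (free_dalg B) = pm_scale" and mul_free: "mul (free_dalg B) = (*)"
  by (simp_all add: free_dalg_def)

lemma word_in_car: "w \<in> words B \<Longrightarrow> word w \<in> car (free_dalg B)"
  by (simp add: car_free)

lemma words_append: "u \<in> words B \<Longrightarrow> v \<in> words B \<Longrightarrow> u @ v \<in> words B"
  by (auto simp: words_def)

interpretation der_free: Vector_Spaces.linear pm_scale pm_scale "der (free_dalg B)" for B
  by (simp add: free_dalg_def linear_lin_ext pm.vector_space_axioms)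

lemma der_free_word: "der (free_dalg B) (word w) = word_der B w"
  by (simp add: free_dalg_def lin_ext_single[OF pm.vector_space_axioms])

locale U_basis =
  fixes B :: "'a::field poly set"
  assumes U_basis: "is_U_basis B"
begin

abbreviation \<D> :: "'a dpoly \<Rightarrow> 'a dpoly"
  where "\<D> \<equiv> der (free_dalg B)"

lemma independent_B: "uea.independent B" and span_B: "uea.span B = UNIV"
  using U_basis by (simp_all add: is_U_basis_def)

lemma lookup_dvar:
  "Poly_Mapping.lookup (dvar B j h) w =
    (\<Sum>b | uea.representation B h b \<noteq> 0. uea.representation B h b when [(j, b)] = w)"
  by (simp add: dvar_def lookup_sum lookup_single)

lemma lookup_dvar_letter: "Poly_Mapping.lookup (dvar B j h) [(j, b)] = uea.representation B h b"
proof -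
  have "(\<Sum>c | uea.representation B h c \<noteq> 0. uea.representation B h c when c = b)
      = uea.representation B h b"
    using uea.finite_representation[of B h] by (simp add: when_def)
  then show ?thesis by (simp add: lookup_dvar)
qed

lemma lookup_dvar_other: "(\<And>b. w \<noteq> [(j, b)]) \<Longrightarrow> Poly_Mapping.lookup (dvar B j h) w = 0"
  unfolding lookup_dvar by (rule sum.neutral) (auto simp: when_def)

text \<open>
  The sum in \<open>dvar\<close> ranges over a support that varies with \<open>h\<close>, so additivity is compared coefficient
  by coefficient.
\<close>

lemma linear_dvar: "Vector_Spaces.linear smult pm_scale (dvar B j)"
  unfolding Vector_Spaces.linear_iff
proof (intro conjI allI)
  show "dvar B j (g + h) = dvar B j g + dvar B j h" for g h
  proof (rule poly_mapping_eqI)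
    show "Poly_Mapping.lookup (dvar B j (g + h)) w = Poly_Mapping.lookup (dvar B j g + dvar B j h) w" for w
      by (cases "\<exists>b. w = [(j, b)]")
        (auto simp: lookup_add lookup_dvar_letter lookup_dvar_other span_B
          uea.representation_add[OF independent_B])
  qed
  show "dvar B j (smult c h) = pm_scale c (dvar B j h)" for c h
  proof (rule poly_mapping_eqI)
    show "Poly_Mapping.lookup (dvar B j (smult c h)) w = Poly_Mapping.lookup (pm_scale c (dvar B j h)) w" for w
      by (cases "\<exists>b. w = [(j, b)]")
        (auto simp: lookup_dvar_letter lookup_dvar_other span_B
          uea.representation_scale[OF independent_B])
  qed
qed (rule uea.vector_space_axioms pm.vector_space_axioms)+

lemma dvar_basis: "b \<in> B \<Longrightarrow> dvar B j b = word [(j, b)]"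
  by (rule poly_mapping_eqI)
    (auto simp: lookup_dvar uea.representation_basis[OF independent_B] lookup_single)

lemma keys_dvar: "Poly_Mapping.keys (dvar B j h) \<subseteq> (\<lambda>b. [(j, b)]) ` B"
proof
  fix w assume w: "w \<in> Poly_Mapping.keys (dvar B j h)"
  then obtain b where b: "w = [(j, b)]" using lookup_dvar_other by (metis in_keys_iff)
  then have "uea.representation B h b \<noteq> 0" using w by (simp add: in_keys_iff lookup_dvar_letter)
  then show "w \<in> (\<lambda>b. [(j, b)]) ` B" using b uea.representation_ne_zero by blast
qed

lemma linear_eq_on_basis:
  assumes "Vector_Spaces.linear smult s F" "Vector_Spaces.linear smult s G"
    and "\<And>b. b \<in> B \<Longrightarrow> F b = G b"
  shows "F h = G h"
proof -
  interpret F: Vector_Spaces.linear smult s F by fact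
  interpret vector_space_pair smult s by unfold_locales
  show ?thesis
    by (rule linear_eq_on[OF assms(1,2), of h B]) (simp_all add: span_B assms(3))
qed

lemma der_dvar: "\<D> (dvar B j h) = dvar B j (eps * h)"
proof (rule linear_eq_on_basis[where s = pm_scale and F = "\<lambda>h. \<D> (dvar B j h)" and G = "\<lambda>h. dvar B j (eps * h)"])
  interpret d: Vector_Spaces.linear smult pm_scale "dvar B j" by (rule linear_dvar)
  show "Vector_Spaces.linear smult pm_scale (\<lambda>h. \<D> (dvar B j h))"
    "Vector_Spaces.linear smult pm_scale (\<lambda>h. dvar B j (eps * h))"
    by (simp_all only: Vector_Spaces.linear_iff uea.vector_space_axioms pm.vector_space_axioms
        d.add d.scale der_free.add der_free.scale distrib_left mult_smult_right simp_thms)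
  show "\<D> (dvar B j b) = dvar B j (eps * b)" if "b \<in> B" for b
    using that by (simp only: dvar_basis der_free_word word_der.simps) (simp add: word_Nil)
qed

lemma word_der_append: "word_der B (u @ v) = word_der B u * word v + word u * word_der B v"
proof (induction u)
  case Nil
  then show ?case by (simp add: word_Nil)
next
  case (Cons x u)
  obtain j b where "x = (j, b)" by force
  then show ?case
    by (simp add: Cons distrib_left distrib_right mult.assoc word_mult)
      (simp add: word_mult mult.assoc[symmetric])
qed

lemma der_mult: "\<D> (f * g) = \<D> f * g + f * \<D> g"
proof -
  have 1: "\<D> (word u * g) = \<D> (word u) * g + word u * \<D> g" for u
    by (rule linear_eq_on_keys[where s = pm_scale and f = g])
      (auto simp: Vector_Spaces.linear_iff uea.vector_space_axioms pm.vector_space_axioms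
        der_free.add der_free.scale distrib_left distrib_right pm_scale_mult
        pm.scale_right_distrib word_mult der_free_word word_der_append simp del: pm_scale_single)
  show ?thesis
    by (rule linear_eq_on_keys[where s = pm_scale and f = f])
      (auto simp: Vector_Spaces.linear_iff uea.vector_space_axioms pm.vector_space_axioms
        der_free.add der_free.scale distrib_left distrib_right pm_scale_mult
        pm.scale_right_distrib 1 simp del: pm_scale_single)
qed

lemma subspace_free: "pm.subspace (car (free_dalg B))"
  by (simp add: car_free supported_eq_span)

lemma dvar_in_car: "dvar B j h \<in> car (free_dalg B)"
  using keys_dvar[of j h] by (auto simp: car_free words_def)

lemma mult_in_car:
  assumes "f \<in> car (free_dalg B)" "g \<in> car (free_dalg B)"
  shows "f * g \<in> car (free_dalg B)"
proof -
  have "u + v \<in> words B" if "u \<in> Poly_Mapping.keys f" "v \<in> Poly_Mapping.keys g" for u v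
    using that assms words_append unfolding car_free plus_list_def by blast
  then show ?thesis using keys_mult[of f g] unfolding car_free by blast
qed

lemma word_der_in_car: "w \<in> words B \<Longrightarrow> word_der B w \<in> car (free_dalg B)"
proof (induction w)
  case Nil
  then show ?case by (simp add: words_def)
next
  case (Cons x w)
  obtain j b where x: "x = (j, b)" by force
  show ?case
  proof (cases "w = []")
    case True
    then show ?thesis by (simp add: x word_Nil dvar_in_car)
  next
    case False
    then have "w \<in> words B" "[(j, b)] \<in> words B" using Cons.prems x by (auto simp: words_def)
    then show ?thesis
      using Cons.IH by (simp add: x pm.subspace_add[OF subspace_free] mult_in_car dvar_in_car word_in_car)
  qed
qed

lemma der_in_car: "f \<in> car (free_dalg B) \<Longrightarrow> \<D> f \<in> car (free_dalg B)"
proof (rule linear_in_subspace[OF _ subspace_free, where F = \<D>])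
  show "Vector_Spaces.linear pm_scale pm_scale \<D>" by unfold_locales
qed (auto simp: car_free der_free_word intro: word_der_in_car[unfolded car_free mem_Collect_eq, THEN subsetD])

sublocale free: l_algebra "free_dalg B"
proof
  show "L_algebra (free_dalg B)"
    unfolding L_algebra_def scl_free mul_free
    by (simp add: pm.vector_space_axioms subspace_free mult_in_car mult.assoc distrib_left
        distrib_right pm_scale_mult der_in_car der_free.add der_free.scale der_mult)
qed

end


section \<open>Substitution is a homomorphism\<close>

locale evaluation = U_basis B + l_algebra A
  for B :: "'a::field poly set" and A :: "('a, 'm::ab_group_add) l_alg"
begin

lemma linear_dsubst: "Vector_Spaces.linear pm_scale (scl A) (dsubst A a)"
  unfolding dsubst_def by (rule linear_lin_ext) (rule vs.vector_space_axioms)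

sublocale dsubst: Vector_Spaces.linear pm_scale "scl A" "dsubst A a" for a
  by (rule linear_dsubst)

lemma dsubst_word: "dsubst A a (word w) = prod_ne (mul A) (map (\<lambda>(j, h). uact A h (a j)) w)"
  by (simp add: dsubst_def lin_ext_single[OF vs.vector_space_axioms])

lemma dsubst_dvar: "dsubst A a (dvar B j h) = uact A h (a j)"
proof (rule linear_eq_on_basis[where s = "scl A" and F = "\<lambda>h. dsubst A a (dvar B j h)" and G = "\<lambda>h. uact A h (a j)"])
  interpret d: Vector_Spaces.linear smult pm_scale "dvar B j" by (rule linear_dvar)
  show "Vector_Spaces.linear smult (scl A) (\<lambda>h. dsubst A a (dvar B j h))"
    by (simp only: Vector_Spaces.linear_iff uea.vector_space_axioms vs.vector_space_axioms
        d.add d.scale dsubst.add dsubst.scale simp_thms)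
qed (simp_all only: linear_uact dvar_basis dsubst_word list.map prod.case prod_ne.simps)

lemma dsubst_in:
  assumes a: "\<And>j. a j \<in> car A" and f: "f \<in> car (free_dalg B)"
  shows "dsubst A a f \<in> car A"
proof (rule linear_in_subspace[OF linear_dsubst subspace_car])
  fix w assume "w \<in> Poly_Mapping.keys f"
  then have "w \<noteq> []" using f by (auto simp: car_free words_def)
  then show "dsubst A a (word w) \<in> car A"
    unfolding dsubst_word by (intro prod_ne_in) (auto intro: uact_in a)
qed

lemma dsubst_mult:
  assumes a: "\<And>j. a j \<in> car A" and f: "f \<in> car (free_dalg B)" and g: "g \<in> car (free_dalg B)"
  shows "dsubst A a (f * g) = mul A (dsubst A a f) (dsubst A a g)"
proof -
  note ins = dsubst_in[OF a]
  have words: "dsubst A a (word u * word v) = mul A (dsubst A a (word u)) (dsubst A a (word v))"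
    if "u \<in> words B" "v \<in> words B" for u v
    using that unfolding word_mult dsubst_word map_append
    by (intro prod_ne_append) (auto simp: words_def intro: uact_in a)
  have 1: "dsubst A a (word u * g) = mul A (dsubst A a (word u)) (dsubst A a g)"
    if u: "u \<in> words B" for u
    using g[unfolded car_free mem_Collect_eq]
  proof (induction g rule: poly_mapping_support_induct)
    case zero
    show ?case by (simp add: mul_0_right ins word_in_car u)
  next
    case (add v c g)
    then have "g \<in> car (free_dalg B)" by (simp add: car_free)
    with add u show ?case
      by (simp add: distrib_left pm_scale_mult dsubst.add dsubst.scale words mul_add_right
          mul_scl_right ins word_in_car car_scl del: pm_scale_single)
  qed
  show ?thesis
    using f[unfolded car_free mem_Collect_eq]
  proof (induction f rule: poly_mapping_support_induct)
    case zero
    show ?case by (simp add: mul_0_left ins g)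
  next
    case (add v c f)
    then have "f \<in> car (free_dalg B)" by (simp add: car_free)
    with add g show ?case
      by (simp add: distrib_right pm_scale_mult dsubst.add dsubst.scale 1 mul_add_left
          mul_scl_left ins word_in_car car_scl del: pm_scale_single)
  qed
qed

lemma dsubst_der:
  assumes a: "\<And>j. a j \<in> car A" and f: "f \<in> car (free_dalg B)"
  shows "dsubst A a (\<D> f) = der A (dsubst A a f)"
proof -
  note ins = dsubst_in[OF a]
  have words: "dsubst A a (word_der B w) = der A (dsubst A a (word w))" if "w \<in> words B" for w
    using that
  proof (induction w)
    case Nil
    then show ?case by (simp add: words_def)
  next
    case (Cons x w)
    obtain j b where x: "x = (j, b)" by force
    then have b: "b \<in> B" using Cons.prems by (simp add: words_def)
    show ?case
    proof (cases "w = []")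
      case True
      then have "word_der B (x # w) = dvar B j (eps * b)" by (simp add: x word_Nil)
      moreover have "word (x # w) = dvar B j b" using True b by (simp add: x dvar_basis)
      ultimately show ?thesis by (simp only: dsubst_dvar uact_eps_mult a)
    next
      case False
      then have w: "w \<in> words B" using Cons.prems by (auto simp: words_def)
      have "word_der B (x # w) = dvar B j (eps * b) * word w + dvar B j b * word_der B w"
        using b by (simp add: x dvar_basis)
      moreover have "word (x # w) = dvar B j b * word w"
        using b by (simp add: x dvar_basis word_mult)
      ultimately show ?thesis
        using Cons.IH[OF w]
        by (simp only: dsubst.add dsubst_mult a w word_in_car dvar_in_car word_der_in_car
            dsubst_dvar uact_eps_mult der_mul ins uact_in)
    qed
  qed
  show ?thesis
    using f[unfolded car_free mem_Collect_eq]
  proof (induction f rule: poly_mapping_support_induct)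
    case zero
    show ?case by (simp add: der_0)
  next
    case (add v c f)
    then have "f \<in> car (free_dalg B)" by (simp add: car_free)
    with add show ?case
      by (simp add: der_free.add der_free.scale dsubst.add dsubst.scale words der_add
          der_scl der_free_word ins word_in_car car_scl del: pm_scale_single)
  qed
qed

lemma dsubst_uact:
  assumes a: "\<And>j. a j \<in> car A" and f: "f \<in> car (free_dalg B)"
  shows "dsubst A a (uact (free_dalg B) h f) = uact A h (dsubst A a f)"
proof (induction h)
  case 0
  show ?case by (simp add: free.uact_0 uact_0)
next
  case (pCons c h)
  then show ?case
    using f by (simp add: free.uact_pCons uact_pCons dsubst_in a dsubst.add dsubst.scale dsubst_der
        free.uact_in scl_free)
qed

text \<open>
  Identities are stable under substitutions because two substitutions compose to a third.
\<close>

lemma dsubst_comp: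
  assumes a: "\<And>j. a j \<in> car A" and g: "\<And>j. g j \<in> car (free_dalg B)"
    and f: "f \<in> car (free_dalg B)"
  shows "dsubst A a (dsubst (free_dalg B) g f) = dsubst A (\<lambda>j. dsubst A a (g j)) f"
proof -
  interpret fr: evaluation B "free_dalg B" by unfold_locales
  show ?thesis
  proof (rule linear_eq_on_keys[where s = "scl A" and f = f])
    show "Vector_Spaces.linear pm_scale (scl A) (\<lambda>f. dsubst A a (dsubst (free_dalg B) g f))"
      by (simp add: Vector_Spaces.linear_iff pm.vector_space_axioms vs.vector_space_axioms
          dsubst.add dsubst.scale fr.dsubst.add fr.dsubst.scale[unfolded scl_free])
    show "Vector_Spaces.linear pm_scale (scl A) (dsubst A (\<lambda>j. dsubst A a (g j)))"
      by (rule linear_dsubst)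
    fix w assume "w \<in> Poly_Mapping.keys f"
    then have "w \<noteq> []" using f by (auto simp: car_free words_def)
    then show "dsubst A a (dsubst (free_dalg B) g (word w)) = dsubst A (\<lambda>j. dsubst A a (g j)) (word w)"
      unfolding fr.dsubst_word dsubst_word
      by (subst prod_ne_hom[where S = "car (free_dalg B)" and F = "dsubst A a" and m' = "mul A",
            THEN conjunct2])
        (auto simp: mul_free dsubst_mult a mult_in_car dsubst_uact g comp_def case_prod_unfold
          intro: free.uact_in)
  qed
qed

theorem T_L_ideal_Id_L: "T_L_ideal B (Id_L B A)"
  unfolding T_L_ideal_def
proof (intro conjI ballI allI impI)
  show "Id_L B A \<subseteq> car (free_dalg B)" by (auto simp: Id_L_def)
  show "pm.subspace (Id_L B A)"
    unfolding pm.subspace_def Id_L_def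
    by (auto simp: dsubst.add dsubst.scale pm.subspace_0[OF subspace_free]
        pm.subspace_add[OF subspace_free] pm.subspace_scale[OF subspace_free])
  fix f assume "f \<in> Id_L B A"
  then have f: "f \<in> car (free_dalg B)" and 0: "\<And>a. (\<And>j. a j \<in> car A) \<Longrightarrow> dsubst A a f = 0"
    by (auto simp: Id_L_def)
  show "f * g \<in> Id_L B A" "g * f \<in> Id_L B A" if "g \<in> car (free_dalg B)" for g
    using f that by (auto simp: Id_L_def mult_in_car dsubst_mult 0 mul_0_left mul_0_right dsubst_in)
  show "uact (free_dalg B) h f \<in> Id_L B A" for h
    using f by (simp add: Id_L_def free.uact_in dsubst_uact 0 uact_zero_right)
  interpret fr: evaluation B "free_dalg B" by unfold_locales
  show "dsubst (free_dalg B) g f \<in> Id_L B A" if "\<forall>j. g j \<in> car (free_dalg B)" for g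
    using f that by (auto simp: Id_L_def fr.dsubst_in dsubst_comp dsubst_in 0)
qed

end

section \<open>Monomial functions are linearly independent\<close>

lemma prod_mset_indicator_power:
  "(\<Prod>i\<in>#m. if i = j then t else 1) = (t :: 'a::comm_monoid_mult) ^ count m j"
  by (induction m) auto

text \<open>
  This is Dedekind's independence of characters: \<open>\<alpha> \<mapsto> \<Prod>\<^sub>i \<alpha> i\<close> is a homomorphism from the
  multiplicative monoid of all \<open>\<alpha>\<close>.  Two monomials with different exponents of the variable \<open>j\<close> are told
  apart by the point \<open>\<beta>\<close> with value 2 at \<open>j\<close> and 1 elsewhere, because powers of 2 are distinct in
  characteristic 0.  Comparing the relation at \<open>\<alpha> \<beta>\<close> with a multiple of the relation at \<open>\<alpha>\<close> removes
  one term.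
\<close>

lemma monomial_functions_independent:
  fixes c :: "'i multiset \<Rightarrow> 'a::field_char_0"
  assumes "finite S" and "\<And>\<alpha>. (\<Sum>m\<in>S. c m * (\<Prod>i\<in>#m. \<alpha> i)) = 0" and "m \<in> S"
  shows "c m = 0"
  using assms
proof (induction S arbitrary: c m rule: finite_induct)
  case empty
  then show ?case by simp
next
  case (insert m0 S)
  let ?\<chi> = "\<lambda>m \<alpha>. \<Prod>i\<in>#m. \<alpha> i :: 'a"
  have S: "c k = 0" if k: "k \<in> S" for k
  proof -
    have "k \<noteq> m0" using insert.hyps k by blast
    then obtain j where j: "count k j \<noteq> count m0 j" by (auto simp: multiset_eq_iff)
    define \<beta> where "\<beta> = (\<lambda>i. if i = j then 2 else (1 :: 'a))"
    have \<beta>: "?\<chi> m \<beta> = of_nat (2 ^ count m j)" for m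
      unfolding \<beta>_def prod_mset_indicator_power by simp
    have split: "(\<Sum>m\<in>S. c m * ?\<chi> m \<alpha>) = - c m0 * ?\<chi> m0 \<alpha>" for \<alpha>
      using insert.prems(1)[of \<alpha>] insert.hyps by (simp add: eq_neg_iff_add_eq_0 add.commute)
    have "?\<chi> k \<beta> \<noteq> ?\<chi> m0 \<beta>" unfolding \<beta> of_nat_eq_iff using j by simp
    moreover have "c k * (?\<chi> k \<beta> - ?\<chi> m0 \<beta>) = 0"
    proof (rule insert.IH[OF _ k])
      fix \<alpha>
      have "(\<Sum>m\<in>S. c m * (?\<chi> m \<beta> - ?\<chi> m0 \<beta>) * ?\<chi> m \<alpha>)
          = (\<Sum>m\<in>S. c m * (?\<chi> m (\<lambda>i. \<alpha> i * \<beta> i))) - ?\<chi> m0 \<beta> * (\<Sum>m\<in>S. c m * ?\<chi> m \<alpha>)"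
        by (simp add: prod_mset.distrib sum_subtractf sum_distrib_left algebra_simps)
      also have "\<dots> = - c m0 * ?\<chi> m0 (\<lambda>i. \<alpha> i * \<beta> i) - ?\<chi> m0 \<beta> * (- c m0 * ?\<chi> m0 \<alpha>)"
        unfolding split ..
      also have "\<dots> = 0" by (simp add: prod_mset.distrib)
      finally show "(\<Sum>m\<in>S. c m * (?\<chi> m \<beta> - ?\<chi> m0 \<beta>) * ?\<chi> m \<alpha>) = 0" .
    qed
    ultimately show ?thesis by simp
  qed
  moreover have "c m0 = 0"
    using insert.prems(1)[of "\<lambda>_. 1"] insert.hyps S by simp
  ultimately show ?case using insert.prems(2) by blast
qed

lemma monomial_coefficients_zero:
  fixes c :: "'w \<Rightarrow> 'a::field_char_0"
  assumes K: "finite K" and 0: "\<And>\<alpha>. (\<Sum>w\<in>K. c w * (\<Prod>i\<in>#g w. \<alpha> i)) = 0"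
  shows "(\<Sum>w | w \<in> K \<and> g w = m. c w) = 0"
proof (cases "m \<in> g ` K")
  case True
  show ?thesis
  proof (rule monomial_functions_independent[OF _ _ True])
    show "(\<Sum>m\<in>g ` K. (\<Sum>w | w \<in> K \<and> g w = m. c w) * (\<Prod>i\<in>#m. \<alpha> i)) = 0" for \<alpha>
    proof -
      have "(\<Sum>m\<in>g ` K. (\<Sum>w | w \<in> K \<and> g w = m. c w) * (\<Prod>i\<in>#m. \<alpha> i))
          = (\<Sum>m\<in>g ` K. \<Sum>w | w \<in> K \<and> g w = m. c w * (\<Prod>i\<in>#g w. \<alpha> i))"
        unfolding sum_distrib_right by (intro sum.cong refl) auto
      also have "\<dots> = (\<Sum>w\<in>K. c w * (\<Prod>i\<in>#g w. \<alpha> i))"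
        by (rule sum.image_gen[OF K, symmetric])
      finally show ?thesis by (simp add: 0)
    qed
  qed (simp add: K)
next
  case False
  then have "{w \<in> K. g w = m} = {}" by auto
  then show ?thesis by (metis (no_types) sum.empty)
qed

lemma (in module) sum_scale_fibres_zero:
  assumes "finite K" and "\<And>y. (\<Sum>w | w \<in> K \<and> g w = y. c w) = 0"
  shows "(\<Sum>w\<in>K. scale (c w) (N (g w))) = 0"
proof -
  have "(\<Sum>w\<in>K. scale (c w) (N (g w)))
      = (\<Sum>y\<in>g ` K. \<Sum>w | w \<in> K \<and> g w = y. scale (c w) (N (g w)))"
    by (rule sum.image_gen[OF assms(1)])
  also have "\<dots> = (\<Sum>y\<in>g ` K. scale (\<Sum>w | w \<in> K \<and> g w = y. c w) (N y))"
    unfolding scale_sum_left by (intro sum.cong refl) auto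
  finally show ?thesis by (simp add: assms(2))
qed


section \<open>Evaluation in \<open>M\<^sub>1\<close>\<close>

lemma M1_simps: "scl M1 = mat_scale" "mul M1 = (**)" "der M1 = eps_der"
  by (simp_all add: M1_def)

interpretation M1: l_algebra M1
  by unfold_locales (rule L_algebra_M1)

lemma mat_scale_entry [simp]: "mat_scale c v $ r $ s = c * v $ r $ s"
  by (simp add: mat_scale_def)

definition M1_elem :: "'a::field \<Rightarrow> 'a \<Rightarrow> 'a ^ 2 ^ 2" where
  "M1_elem \<alpha> \<beta> = mat_scale \<alpha> (munit 2 2) + mat_scale \<beta> (munit 1 2)"

lemma M1_elem: "M1_elem \<alpha> \<beta> \<in> car M1" "M1_elem \<alpha> \<beta> $ 2 $ 2 = \<alpha>" "M1_elem \<alpha> \<beta> $ 1 $ 2 = \<beta>"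
  by (auto simp: M1_elem_def car_M1 munit_def)

text \<open>
  The eigenvalues of the derivation are 0 on \<open>e\<^sub>2\<^sub>2\<close> and 1 on \<open>e\<^sub>1\<^sub>2\<close>.
\<close>

lemma uact_M1:
  assumes "v \<in> car M1"
  shows "uact M1 h v $ 1 $ 2 = poly h 1 * v $ 1 $ 2" "uact M1 h v $ 2 $ 2 = poly h 0 * v $ 2 $ 2"
proof (induction h)
  case 0
  { case 1 show ?case by (simp add: M1.uact_0)
  next case 2 show ?case by (simp add: M1.uact_0) }
next
  case (pCons c h)
  { case 1 show ?case using assms pCons
      by (simp add: M1.uact_pCons M1_simps eps_der_def munit_def algebra_simps)
  next case 2 show ?case using assms pCons
      by (simp add: M1.uact_pCons M1_simps eps_der_def munit_def) }
qed

lemma prod_ne_M1: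
  assumes "xs \<noteq> []" "set xs \<subseteq> car M1"
  shows "prod_ne (**) xs $ 1 $ 2 = hd xs $ 1 $ 2 * prod_list (map (\<lambda>x. x $ 2 $ 2) (tl xs))"
    and "prod_ne (**) xs $ 2 $ 2 = prod_list (map (\<lambda>x. x $ 2 $ 2) xs)"
  using assms
proof (induction xs rule: list_nonempty_induct)
  case (single x)
  { case 1 show ?case by simp
  next case 2 show ?case by simp }
next
  case (cons x xs)
  then obtain z zs where xs: "xs = z # zs" by (cases xs) auto
  { case 1 then show ?case using cons
      by (simp add: xs matrix_matrix_mult_def sum_2 car_M1)
  next case 2 then show ?case using cons
      by (simp add: xs matrix_matrix_mult_def sum_2 car_M1) }
qed

text \<open>
  Up to the values of the variables, the next two scalars are the entries at \<open>e\<^sub>2\<^sub>2\<close> and at \<open>e\<^sub>1\<^sub>2\<close> of a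
  value of the word; in the second one the first letter contributes through its \<open>e\<^sub>1\<^sub>2\<close> component and
  all others through their \<open>e\<^sub>2\<^sub>2\<close> components.
\<close>

definition at_0 :: "(nat \<times> 'a::field poly) list \<Rightarrow> 'a" where
  "at_0 w = (\<Prod>(j, h)\<leftarrow>w. poly h 0)"

definition at_1_0 :: "(nat \<times> 'a::field poly) list \<Rightarrow> 'a" where
  "at_1_0 w = poly (snd (hd w)) 1 * at_0 (tl w)"

context U_basis
begin

sublocale ev1: evaluation B M1 ..

sublocale evf: evaluation B "free_dalg B" ..

lemma dsubst_M1_word:
  fixes a :: "nat \<Rightarrow> 'a ^ 2 ^ 2"
  assumes a: "\<And>j. a j \<in> car M1" and w: "w \<noteq> []"
  shows "dsubst M1 a (word w) $ 1 $ 2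
      = at_1_0 w * a (fst (hd w)) $ 1 $ 2 * (\<Prod>j\<in>#mset (map fst (tl w)). a j $ 2 $ 2)"
    and "dsubst M1 a (word w) $ 2 $ 2 = at_0 w * (\<Prod>j\<in>#mset (map fst w). a j $ 2 $ 2)"
proof -
  let ?xs = "map (\<lambda>(j, h). uact M1 h (a j)) w"
  have 22: "prod_list (map (\<lambda>x. x $ 2 $ 2) (map (\<lambda>(j, h). uact M1 h (a j)) v))
      = at_0 v * (\<Prod>j\<in>#mset (map fst v). a j $ 2 $ 2)" for v
    by (induction v) (auto simp: at_0_def uact_M1 a)
  have xs: "?xs \<noteq> []" "set ?xs \<subseteq> car M1" using w a by (auto intro: M1.uact_in)
  show "dsubst M1 a (word w) $ 2 $ 2 = at_0 w * (\<Prod>j\<in>#mset (map fst w). a j $ 2 $ 2)"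
    unfolding ev1.dsubst_word M1_simps prod_ne_M1[OF xs] 22 ..
  show "dsubst M1 a (word w) $ 1 $ 2
      = at_1_0 w * a (fst (hd w)) $ 1 $ 2 * (\<Prod>j\<in>#mset (map fst (tl w)). a j $ 2 $ 2)"
    unfolding ev1.dsubst_word M1_simps prod_ne_M1[OF xs] map_tl[symmetric] 22
    using w by (cases w) (auto simp: at_1_0_def uact_M1 a)
qed

lemma linear_entry_M1:
  fixes a :: "nat \<Rightarrow> 'a ^ 2 ^ 2"
  shows "Vector_Spaces.linear pm_scale (*) (\<lambda>f. dsubst M1 a f $ r $ s)"
  by (simp add: Vector_Spaces.linear_iff ev1.dsubst.add ev1.dsubst.scale M1_simps
      pm.vector_space_axioms vector_space_mult)

lemma entry_M1_expand:
  fixes a :: "nat \<Rightarrow> 'a ^ 2 ^ 2"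
  shows
  "dsubst M1 a f $ r $ s = (\<Sum>w\<in>Poly_Mapping.keys f. Poly_Mapping.lookup f w * dsubst M1 a (word w) $ r $ s)"
proof -
  interpret E: Vector_Spaces.linear pm_scale "(*)" "\<lambda>f. dsubst M1 a f $ r $ s" by (rule linear_entry_M1)
  have "dsubst M1 a f $ r $ s
      = dsubst M1 a (\<Sum>w\<in>Poly_Mapping.keys f. pm_scale (Poly_Mapping.lookup f w) (word w)) $ r $ s"
    using poly_mapping_expand[of "Poly_Mapping.keys f" f] by simp
  then show ?thesis by (simp only: E.sum E.scale)
qed

lemma dsubst_M1_eq_0_iff:
  assumes "\<And>j. a j \<in> car M1" "f \<in> car (free_dalg B)"
  shows "dsubst M1 a f = 0 \<longleftrightarrow> dsubst M1 a f $ 1 $ 2 = 0 \<and> dsubst M1 a f $ 2 $ 2 = 0"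
  using ev1.dsubst_in[OF assms] by (auto simp: vec_eq_iff forall_2 car_M1)

text \<open>
  On \<open>M\<^sub>1\<close> the elements \<open>1 - \<epsilon>\<close> and \<open>\<epsilon>\<close> act as the projections to \<open>e\<^sub>2\<^sub>2\<close> and \<open>e\<^sub>1\<^sub>2\<close>, so \<open>p j\<close> and \<open>q j\<close>
  are the generic elements of the two components.
\<close>

abbreviation p :: "nat \<Rightarrow> 'a dpoly" where "p j \<equiv> dvar B j (1 - eps)"

abbreviation q :: "nat \<Rightarrow> 'a dpoly" where "q j \<equiv> dvar B j eps"

definition P :: "nat list \<Rightarrow> 'a dpoly" where "P js = (\<Prod>j\<leftarrow>js. p j)"

lemma P_simps: "P [] = 1" "P (j # js) = p j * P js"
  by (simp_all add: P_def)

end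


section \<open>Reduction to normal form\<close>

text \<open>
  The ideal is an arbitrary one containing the relations.  The variable \<open>i'\<close> of the last relation is
  kept independent of \<open>i\<close> and \<open>j\<close>: word reversal exchanges the roles of the variables in the first
  two relations but not in the last.
\<close>

locale M1_relations = U_basis B for B :: "'a::field poly set" +
  fixes I :: "'a dpoly set" and i j i' :: nat
  assumes ideal: "T_L_ideal B I" and ij: "i \<noteq> j"
    and rel_right: "dvar B i 1 * dvar B j eps \<in> I"
    and rel_comm: "dvar B i eps * dvar B j 1 - dvar B j eps * dvar B i 1
        - (dvar B i 1 * dvar B j 1 - dvar B j 1 * dvar B i 1) \<in> I"
    and rel_idem: "dvar B i' (eps ^ 2) - dvar B i' eps \<in> I"
begin

lemma I_sub: "I \<subseteq> car (free_dalg B)" and subspace_I: "pm.subspace I"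
  using ideal by (simp_all add: T_L_ideal_def)

lemma I_mult: "f \<in> I \<Longrightarrow> g \<in> car (free_dalg B) \<Longrightarrow> f * g \<in> I \<and> g * f \<in> I"
  using ideal by (simp add: T_L_ideal_def)

lemma I_subst: "f \<in> I \<Longrightarrow> (\<And>k. g k \<in> car (free_dalg B)) \<Longrightarrow> dsubst (free_dalg B) g f \<in> I"
  using ideal by (simp add: T_L_ideal_def)

lemma I_der: "f \<in> I \<Longrightarrow> \<D> f \<in> I"
  using ideal I_sub free.uact_eps[of f] unfolding T_L_ideal_def by (metis subsetD)

lemmas I_add = pm.subspace_add[OF subspace_I] and I_diff = pm.subspace_diff[OF subspace_I]
  and I_scale = pm.subspace_scale[OF subspace_I] and I_sum = pm.subspace_sum[OF subspace_I]
  and I_0 = pm.subspace_0[OF subspace_I]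

lemma I_P: "f \<in> I \<Longrightarrow> f * P js \<in> I"
proof (induction js arbitrary: f)
  case Nil
  then show ?case by (simp add: P_simps)
next
  case (Cons k js)
  then have "f * p k * P js \<in> I" using I_mult dvar_in_car by blast
  then show ?case by (simp add: P_simps mult.assoc)
qed

lemma rel_subst:
  assumes "f \<in> car (free_dalg B)" "g \<in> car (free_dalg B)"
  shows "f * \<D> g \<in> I" "\<D> f * g - \<D> g * f - (f * g - g * f) \<in> I" "\<D> (\<D> f) - \<D> f \<in> I"
proof -
  \<comment> \<open>As \<open>i \<noteq> j\<close>, the two variables of a relation can be replaced independently.\<close>
  define a where "a = (\<lambda>_. g)(i := f)"
  have a: "a k \<in> car (free_dalg B)" for k using assms by (simp add: a_def)
  have ai: "a i = f" "a j = g" using ij by (simp_all add: a_def)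
  have eps2: "uact (free_dalg B) (eps ^ 2) f = \<D> (\<D> f)"
    using assms by (simp add: power2_eq_square free.uact_eps_mult[of f eps, simplified] free.uact_eps[simplified])
  note s = evf.dsubst.diff evf.dsubst_mult a dvar_in_car mult_in_car evf.dsubst_dvar mul_free
    free.uact_1 free.uact_eps assms ai eps2
  show "f * \<D> g \<in> I" using I_subst[where g = a, OF rel_right a] by (simp add: s)
  show "\<D> f * g - \<D> g * f - (f * g - g * f) \<in> I" using I_subst[where g = a, OF rel_comm a] by (simp add: s)
  show "\<D> (\<D> f) - \<D> f \<in> I" using I_subst[OF rel_idem, of "\<lambda>_. f"] by (simp add: s)
qed

sublocale dvar: Vector_Spaces.linear smult pm_scale "dvar B k" for k
  by (rule linear_dvar)

lemma der_x: "\<D> (dvar B k 1) = q k"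
  by (simp add: der_dvar)

lemma mult_q: "f \<in> car (free_dalg B) \<Longrightarrow> f * q k \<in> I"
  using rel_subst(1)[of f "dvar B k 1"] dvar_in_car der_x by simp

lemma p_eq: "p k = dvar B k 1 - q k"
  by (simp only: dvar.diff)

text \<open>
  Of the products obtained by expanding \<open>p k = x\<^sub>k - q k\<close>, those which end in some \<open>q\<close> lie in \<open>I\<close>, and
  the others add up to the second relation.
\<close>

lemma p_commute: "p k * p l - p l * p k \<in> I"
proof -
  let ?x = "dvar B k 1" and ?y = "dvar B l 1"
  have "p k * p l - p l * p k = (q k * q l - q l * q k) + (?y * q k - ?x * q l)
      - (q k * ?y - q l * ?x - (?x * ?y - ?y * ?x))"
    by (simp add: p_eq algebra_simps)
  also have "\<dots> \<in> I"
    using rel_subst(2)[of ?x ?y]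
    by (intro I_diff[OF I_add[OF I_diff I_diff]] mult_q) (simp_all add: dvar_in_car der_x)
  finally show ?thesis .
qed

text \<open>
  As \<open>\<epsilon>\<close> is idempotent modulo \<open>I\<close>, only the values of \<open>h\<close> at 0 and 1 count.  The induction is Horner's
  scheme \<open>h = c + \<epsilon> h'\<close>, where multiplication by \<open>\<epsilon>\<close> is the derivation, under which \<open>I\<close> is stable.
\<close>

lemma dvar_reduce: "dvar B k h - (pm_scale (poly h 0) (p k) + pm_scale (poly h 1) (q k)) \<in> I"
proof (induction h)
  case 0
  then show ?case by (simp add: I_0)
next
  case (pCons c h)
  let ?r = "dvar B k h - (pm_scale (poly h 0) (p k) + pm_scale (poly h 1) (q k))"
  have Dq: "\<D> (q k) - q k \<in> I"
    using rel_subst(3)[of "dvar B k 1" "dvar B k 1"] by (simp add: dvar_in_car der_x)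
  have "dvar B k (pCons c h) = dvar B k (smult c 1 + eps * h)"
    by (simp add: one_pCons)
  also have "\<dots> = pm_scale c (p k + q k) + \<D> (dvar B k h)"
    unfolding dvar.add dvar.scale der_dvar p_eq by simp
  finally have "dvar B k (pCons c h)
      - (pm_scale (poly (pCons c h) 0) (p k) + pm_scale (poly (pCons c h) 1) (q k))
    = \<D> ?r + pm_scale (poly h 1 - poly h 0) (\<D> (q k) - q k)"
    by (simp add: der_free.add der_free.diff der_free.scale p_eq der_x pm.scale_left_distrib
        pm.scale_right_distrib pm.scale_left_diff_distrib pm.scale_right_diff_distrib algebra_simps)
  also have "\<dots> \<in> I" by (intro I_add I_der pCons.IH I_scale Dq)
  finally show ?case .
qed

text \<open>
  Induction from the right end of the word: the letter put in front annihilates the summand that starts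
  with a \<open>q\<close>, so every letter that is no longer the first survives only through its \<open>p\<close> part.
\<close>

lemma word_reduce:
  assumes "w \<in> words B"
  shows "word w - (pm_scale (at_0 w) (P (map fst w))
      + pm_scale (at_1_0 w) (q (fst (hd w)) * P (map fst (tl w)))) \<in> I"
  using assms
proof (induction w)
  case Nil
  then show ?case by (simp add: words_def)
next
  case (Cons x w)
  obtain k b where x: "x = (k, b)" by force
  then have b: "b \<in> B" using Cons.prems by (simp add: words_def)
  let ?h = "pm_scale (poly b 0) (p k) + pm_scale (poly b 1) (q k)"
  have r: "word [x] - ?h \<in> I"
    using dvar_reduce[of k b] unfolding x dvar_basis[OF b] .
  have X: "word [x] \<in> car (free_dalg B)" using b x by (simp add: word_in_car words_def)
  have "word (x # w) - pm_scale (at_0 w) (?h * P (map fst w)) \<in> I"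
  proof (cases "w = []")
    case True
    then show ?thesis using r by (simp add: P_simps at_0_def)
  next
    case False
    then have "w \<in> words B" using Cons.prems by (auto simp: words_def)
    note IH = Cons.IH[OF this]
    let ?t = "q (fst (hd w)) * P (map fst (tl w))"
    have "word (x # w) - pm_scale (at_0 w) (?h * P (map fst w))
      = word [x] * (word w - (pm_scale (at_0 w) (P (map fst w)) + pm_scale (at_1_0 w) ?t))
        + pm_scale (at_0 w) ((word [x] - ?h) * P (map fst w))
        + pm_scale (at_1_0 w) ((word [x] * q (fst (hd w))) * P (map fst (tl w)))"
      by (simp add: right_diff_distrib distrib_left left_diff_distrib pm_scale_mult mult.assoc
          word_mult pm.scale_right_diff_distrib)
    also have "\<dots> \<in> I"
      using IH X r by (intro I_add I_scale I_P mult_q) (simp_all add: I_mult)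
    finally show ?thesis .
  qed
  moreover have "pm_scale (at_0 w) (?h * P (map fst w))
      = pm_scale (at_0 (x # w)) (P (map fst (x # w)))
        + pm_scale (at_1_0 (x # w)) (q (fst (hd (x # w))) * P (map fst (tl (x # w))))"
    by (simp add: x at_1_0_def at_0_def P_simps distrib_right pm_scale_mult
        pm.scale_right_distrib mult.commute)
  ultimately show ?case by simp
qed

lemma P_move_front: "k \<in> set js \<Longrightarrow> P js - p k * P (remove1 k js) \<in> I"
proof (induction js)
  case Nil
  then show ?case by simp
next
  case (Cons l js)
  show ?case
  proof (cases "k = l")
    case True
    then show ?thesis by (simp add: P_simps I_0)
  next
    case False
    have "P (l # js) - p k * P (remove1 k (l # js))
      = p l * (P js - p k * P (remove1 k js)) + (p l * p k - p k * p l) * P (remove1 k js)"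
      using False by (simp add: P_simps algebra_simps)
    also have "\<dots> \<in> I"
      using Cons False by (intro I_add I_P p_commute) (simp add: I_mult dvar_in_car)
    finally show ?thesis .
  qed
qed

lemma P_permute: "mset js = mset ks \<Longrightarrow> P js - P ks \<in> I"
proof (induction js arbitrary: ks)
  case Nil
  then show ?case by (simp add: I_0)
next
  case (Cons k js)
  then have k: "k \<in> set ks" by (metis list.set_intros(1) set_mset_mset)
  have "mset js = mset (remove1 k ks)" using Cons.prems by (metis add_mset_remove_trivial mset.simps(2) mset_remove1)
  then have "p k * (P js - P (remove1 k ks)) - (P ks - p k * P (remove1 k ks)) \<in> I"
    using Cons.IH k by (intro I_diff P_move_front) (simp_all add: I_mult dvar_in_car)
  then show ?case by (simp add: P_simps right_diff_distrib)
qed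

text \<open>
  Modulo \<open>I\<close> the normal forms of \<open>word_reduce\<close> depend only on a multiset of variables, respectively on a
  first variable and a multiset, because the \<open>p j\<close> commute.  Collecting equal normal forms, \<open>f\<close> is
  congruent to a combination of them with the coefficients \<open>c0\<close> and \<open>c1\<close>.
\<close>

lemma coefficients_zero_imp_in_I:
  assumes f: "f \<in> car (free_dalg B)"
    and c0: "\<And>m. (\<Sum>w | w \<in> Poly_Mapping.keys f \<and> mset (map fst w) = m.
        Poly_Mapping.lookup f w * at_0 w) = 0"
    and c1: "\<And>m. (\<Sum>w | w \<in> Poly_Mapping.keys f \<and> (fst (hd w), mset (map fst (tl w))) = m.
        Poly_Mapping.lookup f w * at_1_0 w) = 0"
  shows "f \<in> I"
proof -
  let ?K = "Poly_Mapping.keys f" and ?c = "Poly_Mapping.lookup f"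
  define N where "N m = P (sorted_list_of_multiset m)" for m
  have PN: "P js - N (mset js) \<in> I" for js
    unfolding N_def by (rule P_permute) simp
  have red: "word w - (pm_scale (at_0 w) (N (mset (map fst w)))
      + pm_scale (at_1_0 w) (q (fst (hd w)) * N (mset (map fst (tl w))))) \<in> I" (is "?r w \<in> I")
    if "w \<in> ?K" for w
  proof -
    have "w \<in> words B" using f that by (auto simp: car_free)
    note word_reduce[OF this]
    moreover have "pm_scale (at_0 w) (P (map fst w) - N (mset (map fst w))) \<in> I"
      by (intro I_scale PN)
    moreover have "pm_scale (at_1_0 w)
        (q (fst (hd w)) * (P (map fst (tl w)) - N (mset (map fst (tl w))))) \<in> I"
      using I_mult[OF PN dvar_in_car] by (intro I_scale) blast
    ultimately have "word w - (pm_scale (at_0 w) (P (map fst w))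
        + pm_scale (at_1_0 w) (q (fst (hd w)) * P (map fst (tl w))))
      + pm_scale (at_0 w) (P (map fst w) - N (mset (map fst w)))
      + pm_scale (at_1_0 w) (q (fst (hd w)) * (P (map fst (tl w)) - N (mset (map fst (tl w))))) \<in> I"
      by (intro I_add)
    then show ?thesis
      by (simp add: pm.scale_right_diff_distrib right_diff_distrib diff_diff_eq)
  qed
  have "f = (\<Sum>w\<in>?K. pm_scale (?c w) (word w))"
    using poly_mapping_expand[of ?K f] by simp
  also have "\<dots> = (\<Sum>w\<in>?K. pm_scale (?c w) (?r w))
      + (\<Sum>w\<in>?K. pm_scale (?c w * at_0 w) (N (mset (map fst w))))
      + (\<Sum>w\<in>?K. pm_scale (?c w * at_1_0 w) (q (fst (hd w)) * N (mset (map fst (tl w)))))"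
    by (simp add: pm.scale_right_diff_distrib pm.scale_right_distrib sum_subtractf sum.distrib
        del: pm_scale_single)
  also have "(\<Sum>w\<in>?K. pm_scale (?c w * at_0 w) (N (mset (map fst w)))) = 0"
    by (rule pm.sum_scale_fibres_zero[OF finite_keys c0])
  also have "(\<Sum>w\<in>?K. pm_scale (?c w * at_1_0 w) (q (fst (hd w)) * N (mset (map fst (tl w))))) = 0"
    using pm.sum_scale_fibres_zero[OF finite_keys c1, where N = "\<lambda>(k, m). q k * N m"] by simp
  finally show ?thesis
    using red by (simp only: add_0_right) (metis (no_types, lifting) I_scale I_sum)
qed

end


section \<open>The differential identities of \<open>M\<^sub>1\<close>\<close>

definition relations_M1 :: "'a::field poly set \<Rightarrow> nat \<Rightarrow> nat \<Rightarrow> nat \<Rightarrow> 'a dpoly set" where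
  "relations_M1 B i j l = {dvar B i 1 * dvar B j eps,
    dvar B i eps * dvar B j 1 - dvar B j eps * dvar B i 1
      - (dvar B i 1 * dvar B j 1 - dvar B j 1 * dvar B i 1),
    dvar B l (eps ^ 2) - dvar B l eps}"

locale U_basis_char_0 = U_basis B for B :: "'a::field_char_0 poly set"
begin

lemma relations_M1_subset_Id: "relations_M1 B i j l \<subseteq> Id_L B M1"
proof -
  have "f \<in> Id_L B M1" if f: "f \<in> relations_M1 B i j l" for f
  proof -
    have fc: "f \<in> car (free_dalg B)"
      using f by (auto simp: relations_M1_def intro!: pm.subspace_diff[OF subspace_free] mult_in_car dvar_in_car)
    have "dsubst M1 a f = 0" if a: "\<forall>k. a k \<in> car M1" for a
    proof -
      have a': "a k \<in> car M1" for k using a by blast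
      have z: "uact M1 h (a k) $ 1 $ 1 = 0" "uact M1 h (a k) $ 2 $ 1 = 0" for h k
        using M1.uact_in[OF a'] by (auto simp: car_M1)
      show ?thesis
        using f unfolding relations_M1_def dsubst_M1_eq_0_iff[OF a' fc]
        by (auto simp: ev1.dsubst.diff ev1.dsubst_mult a' dvar_in_car ev1.dsubst_dvar M1_simps
            matrix_matrix_mult_def sum_2 uact_M1 z)
    qed
    then show ?thesis using fc by (simp add: Id_L_def)
  qed
  then show ?thesis by blast
qed

text \<open>
  The first sum is the coefficient of a monomial in the \<open>\<alpha>\<close> at \<open>e\<^sub>2\<^sub>2\<close>.  For the second, let \<open>\<beta>\<close> be the
  indicator function of \<open>k\<close>: then the entry at \<open>e\<^sub>1\<^sub>2\<close> only sees the words that start with \<open>x\<^sub>k\<close>.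
\<close>

lemma Id_L_M1_coefficients_zero:
  assumes f: "f \<in> Id_L B M1"
  shows "(\<Sum>w | w \<in> Poly_Mapping.keys f \<and> mset (map fst w) = m.
        Poly_Mapping.lookup f w * at_0 w) = 0" (is "?A m")
    and "(\<Sum>w | w \<in> Poly_Mapping.keys f \<and> (fst (hd w), mset (map fst (tl w))) = m'.
        Poly_Mapping.lookup f w * at_1_0 w) = 0" (is "?B m'")
proof -
  let ?K = "Poly_Mapping.keys f" and ?c = "Poly_Mapping.lookup f"
  have ne: "w \<noteq> []" if "w \<in> ?K" for w
    using that f by (auto simp: Id_L_def car_free words_def)
  have 0: "(\<Sum>w\<in>?K. ?c w * dsubst M1 (\<lambda>k. M1_elem (\<alpha> k) (\<beta> k)) (word w) $ r $ s) = 0" for \<alpha> \<beta> r s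
    unfolding entry_M1_expand[symmetric] using f by (simp add: Id_L_def M1_elem)
  show "?A m"
  proof (rule monomial_coefficients_zero)
    show "(\<Sum>w\<in>?K. ?c w * at_0 w * (\<Prod>k\<in>#mset (map fst w). \<alpha> k)) = 0" for \<alpha>
      using 0[of \<alpha> "\<lambda>_. 0" 2 2] by (simp add: dsubst_M1_word ne M1_elem mult.assoc del: mset_map cong: sum.cong)
  qed simp
  obtain k m where m': "m' = (k, m)" by force
  have "(\<Sum>w | w \<in> ?K \<and> mset (map fst (tl w)) = m.
      ?c w * at_1_0 w * (if fst (hd w) = k then 1 else 0)) = 0"
  proof (rule monomial_coefficients_zero)
    show "(\<Sum>w\<in>?K. ?c w * at_1_0 w * (if fst (hd w) = k then 1 else 0)
        * (\<Prod>k\<in>#mset (map fst (tl w)). \<alpha> k)) = 0" for \<alpha>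
      using 0[of \<alpha> "\<lambda>l. if l = k then 1 else 0" 1 2]
      by (simp add: dsubst_M1_word ne M1_elem mult.assoc del: mset_map cong: sum.cong)
  qed simp
  moreover have "(\<Sum>w | w \<in> ?K \<and> mset (map fst (tl w)) = m.
      ?c w * at_1_0 w * (if fst (hd w) = k then 1 else 0))
    = (\<Sum>w | w \<in> ?K \<and> (fst (hd w), mset (map fst (tl w))) = m'. ?c w * at_1_0 w)"
    by (rule sum.mono_neutral_cong_right) (auto simp: m')
  ultimately show "?B m'" by simp
qed

theorem Id_L_M1:
  assumes "i \<noteq> j"
  shows "Id_L B M1 = T_L_gen B (relations_M1 B i j l)"
proof
  show "T_L_gen B (relations_M1 B i j l) \<subseteq> Id_L B M1"
    unfolding T_L_gen_def using ev1.T_L_ideal_Id_L relations_M1_subset_Id by blast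
  show "Id_L B M1 \<subseteq> T_L_gen B (relations_M1 B i j l)"
    unfolding T_L_gen_def
  proof (intro subsetI InterI)
    fix f I assume f: "f \<in> Id_L B M1" and "I \<in> {I. T_L_ideal B I \<and> relations_M1 B i j l \<subseteq> I}"
    then interpret M1_relations B I i j l
      by unfold_locales (auto simp: relations_M1_def assms)
    show "f \<in> I"
      using f by (intro coefficients_zero_imp_in_I Id_L_M1_coefficients_zero) (auto simp: Id_L_def)
  qed
qed

end

section \<open>Reversal of words and opposite algebras\<close>

definition reverse :: "('g list \<Rightarrow>\<^sub>0 'a::field) \<Rightarrow> ('g list \<Rightarrow>\<^sub>0 'a)"
  where "reverse = push rev"

interpretation reverse: Vector_Spaces.linear pm_scale pm_scale reverse
  unfolding reverse_def by (rule linear_push)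

lemma reverse_word: "reverse (word w) = word (rev w)"
  by (simp add: reverse_def push_single)

lemma reverse_reverse [simp]: "reverse (reverse f) = f"
  by (rule linear_eq_on_keys[where s = pm_scale and F = "\<lambda>f. reverse (reverse f)" and G = "\<lambda>f. f" and f = f])
    (simp_all add: Vector_Spaces.linear_iff pm.vector_space_axioms reverse.add reverse.scale
      reverse_word del: pm_scale_single)

lemma reverse_mult: "reverse (f * g) = reverse g * reverse f"
proof -
  have 1: "reverse (word u * g) = reverse g * reverse (word u)" for u
    by (rule linear_eq_on_keys[where s = pm_scale and F = "\<lambda>g. reverse (word u * g)"
          and G = "\<lambda>g. reverse g * reverse (word u)" and f = g])
      (simp_all add: Vector_Spaces.linear_iff pm.vector_space_axioms reverse.add reverse.scale
        distrib_left distrib_right pm_scale_mult word_mult reverse_word del: pm_scale_single)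
  show ?thesis
    by (rule linear_eq_on_keys[where s = pm_scale and F = "\<lambda>f. reverse (f * g)"
          and G = "\<lambda>f. reverse g * reverse f" and f = f])
      (simp_all add: Vector_Spaces.linear_iff pm.vector_space_axioms reverse.add reverse.scale
        distrib_left distrib_right pm_scale_mult 1 del: pm_scale_single)
qed

lemma reverse_in_car: "f \<in> car (free_dalg B) \<Longrightarrow> reverse f \<in> car (free_dalg B)"
  using keys_push[of rev f] unfolding reverse_def by (fastforce simp: car_free words_def)

text \<open>
  Anti-homomorphisms are used for word reversal itself and for the map from \<open>M\<^sub>1\<close> to \<open>M\<^sub>2\<close>.  The
  conclusion that matters is \<open>dsubst_anti\<close>: applying \<open>\<theta>\<close> to a value of \<open>f\<close> evaluates the reversed
  polynomial.
\<close>

locale anti_hom = U_basis B + A: l_algebra A + A': l_algebra A'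
  for B :: "'a::field poly set" and A :: "('a, 'm::ab_group_add) l_alg"
    and A' :: "('a, 'n::ab_group_add) l_alg" +
  fixes \<theta> :: "'m \<Rightarrow> 'n"
  assumes linear: "Vector_Spaces.linear (scl A) (scl A') \<theta>"
    and in_car: "x \<in> car A \<Longrightarrow> \<theta> x \<in> car A'"
    and mult: "x \<in> car A \<Longrightarrow> y \<in> car A \<Longrightarrow> \<theta> (mul A x y) = mul A' (\<theta> y) (\<theta> x)"
    and deriv: "x \<in> car A \<Longrightarrow> \<theta> (der A x) = der A' (\<theta> x)"
begin

sublocale \<theta>: Vector_Spaces.linear "scl A" "scl A'" \<theta>
  by (rule linear)

sublocale A: evaluation B A ..
sublocale A': evaluation B A' ..

lemma uact_anti: "x \<in> car A \<Longrightarrow> \<theta> (uact A h x) = uact A' h (\<theta> x)"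
  by (induction h)
    (simp_all add: A.uact_0 A'.uact_0 A.uact_pCons A'.uact_pCons in_car \<theta>.add \<theta>.scale deriv A.uact_in)

lemma prod_ne_anti:
  assumes "xs \<noteq> []" "set xs \<subseteq> car A"
  shows "\<theta> (prod_ne (mul A) xs) = prod_ne (mul A') (rev (map \<theta> xs))"
  using assms
proof (induction xs rule: list_nonempty_induct)
  case (single x)
  then show ?case by simp
next
  case (cons x xs)
  then obtain z zs where xs: "xs = z # zs" by (cases xs) auto
  have "prod_ne (mul A') (rev (map \<theta> (x # xs)))
      = mul A' (prod_ne (mul A') (rev (map \<theta> xs))) (prod_ne (mul A') [\<theta> x])"
    unfolding list.map rev.simps
    by (rule A'.prod_ne_append) (use cons in_car in auto)
  then show ?case using cons by (simp add: xs mult A.prod_ne_in)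
qed

lemma dsubst_anti:
  assumes a: "\<And>j. a j \<in> car A" and f: "f \<in> car (free_dalg B)"
  shows "dsubst A' (\<lambda>j. \<theta> (a j)) (reverse f) = \<theta> (dsubst A a f)"
proof (rule linear_eq_on_keys[where s = "scl A'" and F = "\<lambda>f. dsubst A' (\<lambda>j. \<theta> (a j)) (reverse f)"
      and G = "\<lambda>f. \<theta> (dsubst A a f)" and f = f])
  fix w assume "w \<in> Poly_Mapping.keys f"
  then have w: "map (\<lambda>(j, h). uact A h (a j)) w \<noteq> []" "set (map (\<lambda>(j, h). uact A h (a j)) w) \<subseteq> car A"
    using f a by (auto simp: car_free words_def intro: A.uact_in)
  show "dsubst A' (\<lambda>j. \<theta> (a j)) (reverse (word w)) = \<theta> (dsubst A a (word w))"
    unfolding reverse_word A.dsubst_word A'.dsubst_word prod_ne_anti[OF w]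
    by (simp add: rev_map comp_def case_prod_unfold uact_anti a)
qed (simp_all add: Vector_Spaces.linear_iff pm.vector_space_axioms A'.vs.vector_space_axioms
      reverse.add reverse.scale A.dsubst.add A.dsubst.scale A'.dsubst.add A'.dsubst.scale
      \<theta>.add \<theta>.scale)

end

context U_basis
begin

lemma reverse_dvar: "reverse (dvar B j h) = dvar B j h"
proof (rule linear_eq_on_basis[where s = pm_scale and F = "\<lambda>h. reverse (dvar B j h)" and G = "dvar B j"])
  interpret d: Vector_Spaces.linear smult pm_scale "dvar B j" by (rule linear_dvar)
  show "Vector_Spaces.linear smult pm_scale (\<lambda>h. reverse (dvar B j h))"
    by (simp only: Vector_Spaces.linear_iff uea.vector_space_axioms pm.vector_space_axioms
        d.add d.scale reverse.add reverse.scale simp_thms)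
qed (simp_all add: linear_dvar dvar_basis reverse_word)

lemma reverse_word_der: "reverse (word_der B w) = word_der B (rev w)"
proof (induction w)
  case Nil
  show ?case by (simp only: word_der.simps reverse.zero rev.simps)
next
  case (Cons x w)
  obtain j b where x: "x = (j, b)" by force
  have "reverse (word_der B (x # w)) = word (rev w) * dvar B j (eps * b) + word_der B (rev w) * word [x]"
    unfolding x word_der.simps reverse.add reverse_mult reverse_dvar reverse_word Cons.IH by simp
  also have "\<dots> = word_der B (rev (x # w))"
    unfolding x rev.simps word_der_append word_der.simps by (simp add: word_Nil add.commute)
  finally show ?case .
qed

lemma reverse_der: "reverse (\<D> f) = \<D> (reverse f)"
  by (rule linear_eq_on_keys[where s = pm_scale and F = "\<lambda>f. reverse (\<D> f)"
        and G = "\<lambda>f. \<D> (reverse f)" and f = f])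
    (simp_all add: Vector_Spaces.linear_iff pm.vector_space_axioms reverse.add reverse.scale
      der_free.add der_free.scale reverse_word der_free_word reverse_word_der del: pm_scale_single)

sublocale rev_free: anti_hom B "free_dalg B" "free_dalg B" reverse
  by unfold_locales
    (simp_all add: scl_free mul_free reverse.add reverse.scale reverse_in_car reverse_mult reverse_der)

text \<open>
  Reversal interchanges left and right multiples, commutes with the derivation, and turns a
  substitution by \<open>g\<close> into the substitution by the reversed \<open>g\<close>.
\<close>

lemma T_L_ideal_reverse:
  assumes I: "T_L_ideal B I"
  shows "T_L_ideal B (reverse ` I)"
proof -
  have sub: "I \<subseteq> car (free_dalg B)" and mult: "\<And>f g. f \<in> I \<Longrightarrow> g \<in> car (free_dalg B) \<Longrightarrow> f * g \<in> I \<and> g * f \<in> I"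
    and act: "\<And>f h. f \<in> I \<Longrightarrow> uact (free_dalg B) h f \<in> I"
    and subst: "\<And>f g. f \<in> I \<Longrightarrow> (\<And>j. g j \<in> car (free_dalg B)) \<Longrightarrow> dsubst (free_dalg B) g f \<in> I"
    and space: "pm.subspace I"
    using I by (simp_all add: T_L_ideal_def)
  have img: "f \<in> reverse ` I \<longleftrightarrow> reverse f \<in> I" for f
    using reverse_reverse[of f] by (auto intro: rev_image_eqI)
  show ?thesis
    unfolding T_L_ideal_def
  proof (intro conjI ballI allI impI)
    show "reverse ` I \<subseteq> car (free_dalg B)" using sub reverse_in_car by blast
    show "pm.subspace (reverse ` I)" by (rule reverse.subspace_image[OF space])
    fix f assume "f \<in> reverse ` I"
    then have f: "reverse f \<in> I" by (simp only: img)
    then have f': "reverse f \<in> car (free_dalg B)" using sub by blast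
    then have fc: "f \<in> car (free_dalg B)" using reverse_in_car by fastforce
    show "f * g \<in> reverse ` I" "g * f \<in> reverse ` I" if "g \<in> car (free_dalg B)" for g
      unfolding img reverse_mult using mult[OF f reverse_in_car[OF that]] by blast+
    show "uact (free_dalg B) h f \<in> reverse ` I" for h
      unfolding img rev_free.uact_anti[OF fc] by (rule act[OF f])
    show "dsubst (free_dalg B) g f \<in> reverse ` I" if g: "\<forall>j. g j \<in> car (free_dalg B)" for g
    proof -
      have "reverse (dsubst (free_dalg B) g f) = dsubst (free_dalg B) (\<lambda>j. reverse (g j)) (reverse f)"
        by (rule rev_free.dsubst_anti[symmetric]) (use g fc in auto)
      also have "\<dots> \<in> I" by (rule subst[OF f]) (use g reverse_in_car in blast)
      finally show ?thesis by (simp only: img)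
    qed
  qed
qed

lemma T_L_gen_reverse: "f \<in> T_L_gen B (reverse ` S) \<longleftrightarrow> reverse f \<in> T_L_gen B S"
proof -
  have 1: "reverse f \<in> T_L_gen B S" if "f \<in> T_L_gen B (reverse ` S)" for f S
    unfolding T_L_gen_def
  proof
    fix I assume "I \<in> {I. T_L_ideal B I \<and> S \<subseteq> I}"
    then have "T_L_ideal B (reverse ` I)" "reverse ` S \<subseteq> reverse ` I"
      using T_L_ideal_reverse by auto
    then have "f \<in> reverse ` I" using that by (auto simp: T_L_gen_def)
    then show "reverse f \<in> I" by auto
  qed
  have "reverse ` reverse ` S = S" by (simp add: image_image)
  then show ?thesis using 1[of f S] 1[of "reverse f" "reverse ` S"] by auto
qed

end


section \<open>The differential identities of \<open>M\<^sub>2\<close>\<close>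

interpretation M2: l_algebra M2
  by unfold_locales (rule L_algebra_M2)

text \<open>
  Reflection in the anti-diagonal is an anti-automorphism of the matrix algebra; it exchanges \<open>e\<^sub>1\<^sub>1\<close>
  with \<open>e\<^sub>2\<^sub>2\<close> and fixes \<open>e\<^sub>1\<^sub>2\<close>, hence maps \<open>M\<^sub>1\<close> onto \<open>M\<^sub>2\<close> and commutes with the derivations.
\<close>

definition flip :: "'a::field ^ 2 ^ 2 \<Rightarrow> 'a ^ 2 ^ 2" where
  "flip v = (\<chi> r s. v $ (if s = 1 then 2 else 1) $ (if r = 1 then 2 else 1))"

lemma flip_flip: "flip (flip v) = v"
  by (simp add: flip_def vec_eq_iff forall_2)

context U_basis
begin

sublocale flip: anti_hom B M1 M2 flip
proof
  show "flip (mul M1 x y) = mul M2 (flip y) (flip x)" for x y :: "'a ^ 2 ^ 2"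
    by (simp add: M1_def M2_def flip_def matrix_matrix_mult_def vec_eq_iff forall_2 sum_2 algebra_simps)
qed (auto simp: M1_def M2_def flip_def mat_scale_def vec_eq_iff forall_2 munit_def eps_der_def algebra_simps)

lemma Id_L_M2_iff: "f \<in> Id_L B M2 \<longleftrightarrow> reverse f \<in> Id_L B M1"
proof -
  have car: "flip v \<in> car M2 \<longleftrightarrow> v \<in> car M1" for v :: "'a ^ 2 ^ 2"
    by (auto simp: car_M1 car_M2 flip_def)
  have 0: "flip v = 0 \<longleftrightarrow> v = 0" for v :: "'a ^ 2 ^ 2"
    by (auto simp: vec_eq_iff forall_2 flip_def)
  have c: "reverse f \<in> car (free_dalg B) \<longleftrightarrow> f \<in> car (free_dalg B)"
    using reverse_in_car[of f B] reverse_in_car[of "reverse f" B] by auto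
  have "dsubst M2 b f = 0" if "reverse f \<in> Id_L B M1" "\<forall>j. b j \<in> car M2" for b
  proof -
    have "dsubst M1 (\<lambda>j. flip (b j)) (reverse f) = 0"
      using that car[of "flip _"] by (auto simp: Id_L_def flip_flip)
    then show ?thesis
      using flip.dsubst_anti[of "\<lambda>j. flip (b j)" "reverse f"] that car[of "flip _"]
      by (simp add: flip_flip 0[THEN iffD2] Id_L_def)
  qed
  moreover have "dsubst M1 a (reverse f) = 0" if "f \<in> Id_L B M2" "\<forall>j. a j \<in> car M1" for a
  proof -
    have "dsubst M2 (\<lambda>j. flip (a j)) f = 0"
      using that by (auto simp: Id_L_def car)
    then show ?thesis
      using flip.dsubst_anti[of a "reverse f"] that c by (simp add: 0 Id_L_def)
  qed
  ultimately show ?thesis by (auto simp: Id_L_def c)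
qed

end

definition relations_M2 :: "'a::field poly set \<Rightarrow> nat \<Rightarrow> nat \<Rightarrow> 'a dpoly set" where
  "relations_M2 B i j = {dvar B i eps * dvar B j 1,
    dvar B i 1 * dvar B j eps - dvar B j 1 * dvar B i eps
      - (dvar B i 1 * dvar B j 1 - dvar B j 1 * dvar B i 1),
    dvar B i (eps ^ 2) - dvar B i eps}"

theorem (in U_basis_char_0) Id_L_M2:
  assumes "i \<noteq> j"
  shows "Id_L B M2 = T_L_gen B (relations_M2 B i j)"
proof -
  \<comment> \<open>Reversing \<open>x\<^sub>j x\<^sub>i\<^sup>\<epsilon>\<close> gives \<open>x\<^sub>i\<^sup>\<epsilon> x\<^sub>j\<close>, so \<open>i\<close> and \<open>j\<close> trade places in the relations of \<open>M\<^sub>1\<close>.\<close>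
  have "relations_M2 B i j = reverse ` relations_M1 B j i i"
    by (simp add: relations_M1_def relations_M2_def reverse.diff reverse_mult reverse_dvar)
  then show ?thesis
    by (intro set_eqI) (simp add: T_L_gen_reverse Id_L_M2_iff Id_L_M1[OF assms[symmetric], of i])
qed

section \<open>Multilinear differential polynomials\<close>

text \<open>
  The words whose letters carry the variables \<open>0, \<dots>, n - 1\<close>, each exactly once.  In this form, and
  with \<open>P_L_eq\<close>, membership in \<open>P_L\<close> is a condition on the support alone.
\<close>

definition multilinear_words :: "'a::field poly set \<Rightarrow> nat \<Rightarrow> (nat \<times> 'a poly) list set" where
  "multilinear_words B n = {w. distinct (map fst w) \<and> fst ` set w = {..<n} \<and> snd ` set w \<subseteq> B}"

lemma multilinear_words_eq:
  "multilinear_words B n = {map (\<lambda>i. (\<sigma> i, h i)) [0..<n] | \<sigma> h.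
      \<sigma> permutes {..<n} \<and> (\<forall>i<n. h i \<in> B)}"
proof (intro equalityI subsetI)
  fix w assume "w \<in> {map (\<lambda>i. (\<sigma> i, h i)) [0..<n] | \<sigma> h. \<sigma> permutes {..<n} \<and> (\<forall>i<n. h i \<in> B)}"
  then obtain \<sigma> h where w: "w = map (\<lambda>i. (\<sigma> i, h i)) [0..<n]" and \<sigma>: "\<sigma> permutes {..<n}"
    and h: "\<forall>i<n. h i \<in> B" by blast
  have "fst ` set w = \<sigma> ` {..<n}" by (simp add: w image_image atLeast0LessThan)
  moreover have "distinct (map fst w)"
    using permutes_inj_on[OF \<sigma>] by (simp add: w comp_def distinct_map)
  ultimately show "w \<in> multilinear_words B n"
    using h permutes_image[OF \<sigma>] by (auto simp: multilinear_words_def w)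
next
  fix w assume "w \<in> multilinear_words B n"
  then have w: "distinct (map fst w)" "set (map fst w) = {..<n}" "snd ` set w \<subseteq> B"
    by (auto simp: multilinear_words_def)
  have len: "length w = n"
    using distinct_card[OF w(1)] w(2) by simp
  define \<sigma> where "\<sigma> i = (if i < n then fst (w ! i) else i)" for i
  have "bij_betw \<sigma> {..<n} {..<n}"
    unfolding bij_betw_def
  proof
    show "inj_on \<sigma> {..<n}"
      using w(1) by (auto simp: inj_on_def \<sigma>_def len distinct_conv_nth)
    have "set (map fst w) = (\<lambda>i. fst (w ! i)) ` {..<n}"
      using nth_image[of n w] by (simp add: image_image[symmetric] len atLeast0LessThan)
    also have "\<dots> = \<sigma> ` {..<n}" by (simp add: \<sigma>_def)
    finally show "\<sigma> ` {..<n} = {..<n}" using w(2) by simp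
  qed
  then have "\<sigma> permutes {..<n}" by (rule bij_imp_permutes) (simp add: \<sigma>_def)
  moreover have "w = map (\<lambda>i. (\<sigma> i, snd (w ! i))) [0..<n]"
    by (rule nth_equalityI) (simp_all add: len \<sigma>_def)
  moreover have "\<forall>i<n. snd (w ! i) \<in> B" using w(3) len by (auto simp: image_subset_iff)
  ultimately show "w \<in> {map (\<lambda>i. (\<sigma> i, h i)) [0..<n] | \<sigma> h. \<sigma> permutes {..<n} \<and> (\<forall>i<n. h i \<in> B)}"
    by (intro CollectI exI[of _ \<sigma>] exI[of _ "\<lambda>i. snd (w ! i)"]) simp
qed

lemma P_L_eq: "P_L B n = {f. Poly_Mapping.keys f \<subseteq> multilinear_words B n}"
proof -
  have image: "F ` {g \<sigma> h | \<sigma> h. Q \<sigma> h} = {F (g \<sigma> h) | \<sigma> h. Q \<sigma> h}"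
    for F :: "'b \<Rightarrow> 'c" and g :: "'d \<Rightarrow> 'e \<Rightarrow> 'b" and Q
    by blast
  show ?thesis
    unfolding supported_eq_span P_L_def multilinear_words_eq image ..
qed

lemma subspace_P_L: "pm.subspace (P_L B n)"
  unfolding P_L_def by (rule pm.subspace_span)

lemma multilinear_words_nonempty: "w \<in> multilinear_words B n \<Longrightarrow> 1 \<le> n \<Longrightarrow> w \<in> words B"
  by (auto simp: multilinear_words_def words_def eq_commute[of "{}"] lessThan_empty_iff)

lemma P_L_subset_car: "1 \<le> n \<Longrightarrow> P_L B n \<subseteq> car (free_dalg B)"
  using multilinear_words_nonempty by (fastforce simp: P_L_eq car_free)

lemma reverse_P_L:
  assumes "f \<in> P_L B n"
  shows "reverse f \<in> P_L B n"
proof -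
  have "rev w \<in> multilinear_words B n" if "w \<in> multilinear_words B n" for w
    using that unfolding multilinear_words_def mem_Collect_eq rev_map[symmetric] distinct_rev set_rev .
  then show ?thesis
    using assms keys_push[of rev f] unfolding reverse_def P_L_eq by blast
qed

abbreviation permute_vars :: "(nat \<Rightarrow> nat) \<Rightarrow> 'a::field dpoly \<Rightarrow> 'a dpoly" where
  "permute_vars \<sigma> \<equiv> push (map (\<lambda>(i, h). (\<sigma> i, h)))"

lemma permute_vars_word:
  assumes "\<sigma> permutes {..<n}" "w \<in> multilinear_words B n"
  shows "map (\<lambda>(i, h). (\<sigma> i, h)) w \<in> multilinear_words B n"
proof -
  have fst: "map fst (map (\<lambda>(i, h). (\<sigma> i, h)) w) = map \<sigma> (map fst w)"
    and snd: "map snd (map (\<lambda>(i, h). (\<sigma> i, h)) w) = map snd w"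
    by (simp_all add: comp_def case_prod_unfold)
  have "distinct (map \<sigma> (map fst w))"
    using assms permutes_inj_on[OF assms(1)] by (simp only: distinct_map[of \<sigma>]) (simp add: multilinear_words_def)
  moreover have "set (map \<sigma> (map fst w)) = {..<n}"
    unfolding set_map using assms(2) permutes_image[OF assms(1)] by (simp add: multilinear_words_def)
  moreover have "set (map snd w) \<subseteq> B" using assms(2) by (simp add: multilinear_words_def)
  ultimately show ?thesis
    unfolding multilinear_words_def mem_Collect_eq set_map[symmetric] fst snd by blast
qed

lemma permute_vars_P_L: "\<sigma> permutes {..<n} \<Longrightarrow> f \<in> P_L B n \<Longrightarrow> permute_vars \<sigma> f \<in> P_L B n"
  using keys_push[of "map (\<lambda>(i, h). (\<sigma> i, h))" f] permute_vars_word[of \<sigma> n _ B]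
  unfolding P_L_eq by blast

lemma permute_vars_reverse: "permute_vars \<sigma> (reverse f) = reverse (permute_vars \<sigma> f)"
proof -
  interpret s: Vector_Spaces.linear pm_scale pm_scale "permute_vars \<sigma>" by (rule linear_push)
  show ?thesis
    by (rule linear_eq_on_keys[where s = pm_scale and F = "\<lambda>f. permute_vars \<sigma> (reverse f)"
          and G = "\<lambda>f. reverse (permute_vars \<sigma> f)" and f = f])
      (simp_all only: Vector_Spaces.linear_iff pm.vector_space_axioms reverse.add reverse.scale
        s.add s.scale reverse_word push_single rev_map simp_thms)
qed

text \<open>
  The element written \<open>x\<^sub>j\<^sup>h x\<^sub>k\<^sup>g \<dots>\<close> for exponents that need not belong to the basis \<open>B\<close>.  It has to be
  distinguished from the single word with these letters, which then is not in the free algebra.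
\<close>

definition (in U_basis) dprod :: "(nat \<times> 'a poly) list \<Rightarrow> 'a dpoly" where
  "dprod w = (\<Prod>(j, h)\<leftarrow>w. dvar B j h)"

lemma (in U_basis) dprod_in_car: "w \<noteq> [] \<Longrightarrow> dprod w \<in> car (free_dalg B)"
  by (induction w rule: list_nonempty_induct) (auto simp: dprod_def dvar_in_car mult_in_car)

lemma (in U_basis) keys_dprod:
  "Poly_Mapping.keys (dprod w) \<subseteq> {v. map fst v = map fst w \<and> snd ` set v \<subseteq> B}"
proof (induction w)
  case Nil
  then show ?case by (simp add: dprod_def zero_list_def)
next
  case (Cons x w)
  obtain j h where x: "x = (j, h)" by force
  have "Poly_Mapping.keys (dprod (x # w)) \<subseteq> {u + v | u v. u \<in> Poly_Mapping.keys (dvar B j h)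
      \<and> v \<in> Poly_Mapping.keys (dprod w)}"
    using keys_mult[of "dvar B j h" "dprod w"] by (simp add: dprod_def x)
  then show ?case using Cons keys_dvar[of j h] by (fastforce simp: plus_list_def x)
qed

text \<open>
  A substitution does not distinguish the two, so formulas for the values of words apply to \<open>dprod\<close>.
\<close>

lemma (in evaluation) dsubst_dprod:
  assumes a: "\<And>j. a j \<in> car A" and "w \<noteq> []"
  shows "dsubst A a (dprod w) = dsubst A a (word w)"
  using assms(2)
proof (induction w rule: list_nonempty_induct)
  case (single x)
  then show ?case by (cases x) (simp add: dprod_def dsubst_dvar dsubst_word del: pm_scale_single)
next
  case (cons x w)
  obtain j h where x: "x = (j, h)" by force
  obtain y v where w: "w = y # v" using cons by (cases w) auto
  have "dsubst A a (dprod (x # w)) = mul A (uact A h (a j)) (dsubst A a (dprod w))"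
    using dsubst_mult[where f = "dvar B j h", OF a dvar_in_car dprod_in_car[OF cons(1)]]
    by (simp add: dprod_def x dsubst_dvar)
  moreover have "dsubst A a (word (x # w)) = mul A (uact A h (a j)) (dsubst A a (word w))"
    by (simp add: dsubst_word x w)
  ultimately show ?case using cons by simp
qed


section \<open>Coordinates on the multilinear quotients\<close>

context U_basis
begin

text \<open>
  The coordinate \<open>n\<close> is the coefficient of \<open>\<Prod>\<^sub>k \<alpha>\<^sub>k\<close> at \<open>e\<^sub>2\<^sub>2\<close>, read off at \<open>x\<^sub>k = e\<^sub>2\<^sub>2\<close>.  The coordinate
  \<open>j < n\<close> is the coefficient of \<open>\<beta>\<^sub>j \<Prod>\<^sub>k \<alpha>\<^sub>k\<close> with \<open>k \<noteq> j\<close> at \<open>e\<^sub>1\<^sub>2\<close>, read off at \<open>x\<^sub>j = e\<^sub>2\<^sub>2 + e\<^sub>1\<^sub>2\<close> and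
  \<open>x\<^sub>k = e\<^sub>2\<^sub>2\<close> for the other \<open>k\<close>.  Permutations of \<open>{..<n}\<close> fix the index \<open>n\<close>, so they act uniformly on
  all indices.
\<close>

definition coord :: "nat \<Rightarrow> nat \<Rightarrow> 'a dpoly \<Rightarrow> 'a" where
  "coord n j f = (if j = n then dsubst M1 (\<lambda>_. M1_elem 1 0) f $ 2 $ 2
    else dsubst M1 (\<lambda>k. M1_elem 1 (if k = j then 1 else 0)) f $ 1 $ 2)"

lemma linear_coord: "Vector_Spaces.linear pm_scale (*) (coord n j)"
  unfolding coord_def using linear_entry_M1 by (cases "j = n") simp_all

lemma coord_word:
  assumes "w \<noteq> []"
  shows "coord n j (word w)
    = (if j = n then at_0 w else if fst (hd w) = j then at_1_0 w else 0)"
  using assms by (simp add: coord_def dsubst_M1_word M1_elem)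

lemma multilinear_entry_22:
  assumes a: "\<And>j. a j \<in> car M1" and n: "1 \<le> n" and f: "f \<in> P_L B n"
  shows "dsubst M1 a f $ 2 $ 2 = coord n n f * (\<Prod>k<n. a k $ 2 $ 2)"
proof (rule linear_eq_on_keys[where s = "(*)" and F = "\<lambda>f. dsubst M1 a f $ 2 $ 2"
      and G = "\<lambda>f. coord n n f * (\<Prod>k<n. a k $ 2 $ 2)" and f = f])
  interpret c: Vector_Spaces.linear pm_scale "(*)" "coord n n" by (rule linear_coord)
  show "Vector_Spaces.linear pm_scale (*) (\<lambda>f. coord n n f * (\<Prod>k<n. a k $ 2 $ 2))"
    by (simp add: Vector_Spaces.linear_iff pm.vector_space_axioms vector_space_mult c.add c.scale
        algebra_simps)
  fix w assume "w \<in> Poly_Mapping.keys f"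
  then have w: "w \<in> multilinear_words B n" using f by (auto simp: P_L_eq)
  then have ne: "w \<noteq> []" using multilinear_words_nonempty[OF w n] by (simp add: words_def)
  have "(\<Prod>k\<in>#mset (map fst w). a k $ 2 $ 2) = (\<Prod>k\<in>set (map fst w). a k $ 2 $ 2)"
    using w prod.distinct_set_conv_list[of "map fst w" "\<lambda>k. a k $ 2 $ 2"]
    by (simp add: multilinear_words_def mset_map[symmetric] prod_mset_prod_list del: mset_map)
  also have "set (map fst w) = {..<n}" using w by (simp add: multilinear_words_def)
  finally show "dsubst M1 a (word w) $ 2 $ 2 = coord n n (word w) * (\<Prod>k<n. a k $ 2 $ 2)"
    unfolding dsubst_M1_word[OF a ne] coord_word[OF ne] by simp
qed (rule linear_entry_M1)

lemma multilinear_entry_12: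
  assumes a: "\<And>j. a j \<in> car M1" and n: "1 \<le> n" and f: "f \<in> P_L B n"
  shows "dsubst M1 a f $ 1 $ 2
    = (\<Sum>j<n. coord n j f * (a j $ 1 $ 2 * (\<Prod>k\<in>{..<n} - {j}. a k $ 2 $ 2)))"
proof (rule linear_eq_on_keys[where s = "(*)" and F = "\<lambda>f. dsubst M1 a f $ 1 $ 2" and f = f
      and G = "\<lambda>f. \<Sum>j<n. coord n j f * (a j $ 1 $ 2 * (\<Prod>k\<in>{..<n} - {j}. a k $ 2 $ 2))"])
  interpret c: Vector_Spaces.linear pm_scale "(*)" "coord n j" for j by (rule linear_coord)
  show "Vector_Spaces.linear pm_scale (*)
      (\<lambda>f. \<Sum>j<n. coord n j f * (a j $ 1 $ 2 * (\<Prod>k\<in>{..<n} - {j}. a k $ 2 $ 2)))"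
    by (simp add: Vector_Spaces.linear_iff pm.vector_space_axioms vector_space_mult c.add c.scale
        distrib_right sum.distrib sum_distrib_left mult.assoc)
  fix w assume "w \<in> Poly_Mapping.keys f"
  then have w: "w \<in> multilinear_words B n" using f by (auto simp: P_L_eq)
  then have ne: "w \<noteq> []" using multilinear_words_nonempty[OF w n] by (simp add: words_def)
  then obtain x v where xv: "w = x # v" by (cases w) auto
  have "(\<Prod>k\<in>#mset (map fst (tl w)). a k $ 2 $ 2) = (\<Prod>k\<in>set (map fst (tl w)). a k $ 2 $ 2)"
    using w prod.distinct_set_conv_list[of "map fst (tl w)" "\<lambda>k. a k $ 2 $ 2"]
    by (simp add: multilinear_words_def xv mset_map[symmetric] prod_mset_prod_list del: mset_map)
  also have "set (map fst (tl w)) = {..<n} - {fst (hd w)}"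
  proof -
    have "fst x \<notin> set (map fst v)" "insert (fst x) (set (map fst v)) = {..<n}"
      using w by (simp_all add: multilinear_words_def xv)
    then show ?thesis by (auto simp: xv simp del: set_map)
  qed
  finally have "dsubst M1 a (word w) $ 1 $ 2
      = at_1_0 w * (a (fst (hd w)) $ 1 $ 2 * (\<Prod>k\<in>{..<n} - {fst (hd w)}. a k $ 2 $ 2))"
    unfolding dsubst_M1_word[OF a ne] by simp
  also have "\<dots> = (\<Sum>j<n. if fst (hd w) = j
      then at_1_0 w * (a j $ 1 $ 2 * (\<Prod>k\<in>{..<n} - {j}. a k $ 2 $ 2)) else 0)"
    using w by (auto simp: multilinear_words_def xv)
  also have "\<dots> = (\<Sum>j<n. coord n j (word w) * (a j $ 1 $ 2 * (\<Prod>k\<in>{..<n} - {j}. a k $ 2 $ 2)))"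
    by (intro sum.cong) (auto simp: coord_word[OF ne])
  finally show "dsubst M1 a (word w) $ 1 $ 2
      = (\<Sum>j<n. coord n j (word w) * (a j $ 1 $ 2 * (\<Prod>k\<in>{..<n} - {j}. a k $ 2 $ 2)))" .
qed (rule linear_entry_M1)

lemma multilinear_Id_M1_iff:
  assumes n: "1 \<le> n" and f: "f \<in> P_L B n"
  shows "f \<in> Id_L B M1 \<longleftrightarrow> (\<forall>j\<in>{..n}. coord n j f = 0)"
proof
  have fc: "f \<in> car (free_dalg B)" using P_L_subset_car[OF n] f by blast
  show "\<forall>j\<in>{..n}. coord n j f = 0" if "f \<in> Id_L B M1"
    using that by (simp add: Id_L_def coord_def M1_elem)
  assume 0: "\<forall>j\<in>{..n}. coord n j f = 0"
  have "dsubst M1 a f = 0" if "\<forall>k. a k \<in> car M1" for a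
  proof -
    have a: "a k \<in> car M1" for k using that by blast
    show ?thesis
      unfolding dsubst_M1_eq_0_iff[OF a fc]
        multilinear_entry_12[OF a n f] multilinear_entry_22[OF a n f]
      using 0 by simp
  qed
  then show "f \<in> Id_L B M1" using fc by (simp add: Id_L_def)
qed

text \<open>
  The exponents of \<open>p\<^sub>0 p\<^sub>1 \<dots> p\<^sub>n\<^sub>-\<^sub>1\<close>, and of \<open>q\<^sub>j\<close> followed by the other \<open>p\<^sub>k\<close>: the multilinear normal forms,
  which are dual to the coordinates.
\<close>

definition dual_word :: "nat \<Rightarrow> nat \<Rightarrow> (nat \<times> 'a poly) list" where
  "dual_word n j = (if j = n then map (\<lambda>k. (k, 1 - eps)) [0..<n]
    else (j, eps) # map (\<lambda>k. (k, 1 - eps)) (remove1 j [0..<n]))"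

lemma at_0_p: "at_0 (map (\<lambda>k. (k, 1 - eps)) js) = 1"
  by (induction js) (simp_all add: at_0_def)

lemma coord_dual:
  assumes n: "1 \<le> n" and i: "i \<le> n" and j: "j \<le> n"
  shows "coord n i (dprod (dual_word n j)) = (if i = j then 1 else 0)"
proof -
  have ne: "dual_word n j \<noteq> []" using n by (simp add: dual_word_def)
  have "coord n i (dprod (dual_word n j)) = coord n i (word (dual_word n j))"
    unfolding coord_def by (simp add: ev1.dsubst_dprod M1_elem ne)
  also have "\<dots> = (if i = j then 1 else 0)"
  proof (cases "j = n")
    case True
    then obtain v where v: "dual_word n j = (0, 1 - eps) # v"
      using n by (simp add: dual_word_def upt_conv_Cons)
    have "at_0 (dual_word n j) = 1" using True by (simp add: dual_word_def at_0_p)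
    moreover have "at_1_0 (dual_word n j) = 0" by (simp add: v at_1_0_def)
    ultimately show ?thesis using True unfolding coord_word[OF ne] by simp
  next
    case False
    then have "at_0 (dual_word n j) = 0" "at_1_0 (dual_word n j) = 1" "fst (hd (dual_word n j)) = j"
      using at_0_p[of "remove1 j [0..<n]"] by (simp_all add: dual_word_def at_1_0_def) (simp add: at_0_def)
    then show ?thesis using False unfolding coord_word[OF ne] by simp
  qed
  finally show ?thesis .
qed

lemma dual_in_P_L:
  assumes "j \<le> n"
  shows "dprod (dual_word n j) \<in> P_L B n"
proof -
  have "distinct (map fst (dual_word n j)) \<and> set (map fst (dual_word n j)) = {..<n}"
    using assms by (auto simp: dual_word_def comp_def image_image)
  then have "v \<in> multilinear_words B n" if "map fst v = map fst (dual_word n j)" "snd ` set v \<subseteq> B" for v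
    using that by (metis (mono_tags, lifting) mem_Collect_eq multilinear_words_def set_map)
  then show ?thesis using keys_dprod[of "dual_word n j"] unfolding P_L_eq by blast
qed

lemma coord_permute:
  assumes \<sigma>: "\<sigma> permutes {..<n}" and n: "1 \<le> n" and f: "f \<in> P_L B n"
  shows "coord n (\<sigma> j) (permute_vars \<sigma> f) = coord n j f"
proof (rule linear_eq_on_keys[where s = "(*)" and F = "\<lambda>f. coord n (\<sigma> j) (permute_vars \<sigma> f)"
      and G = "coord n j" and f = f])
  interpret c: Vector_Spaces.linear pm_scale "(*)" "coord n j" for j by (rule linear_coord)
  interpret s: Vector_Spaces.linear pm_scale pm_scale "permute_vars \<sigma>" by (rule linear_push)
  show "Vector_Spaces.linear pm_scale (*) (\<lambda>f. coord n (\<sigma> j) (permute_vars \<sigma> f))"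
    by (simp only: Vector_Spaces.linear_iff pm.vector_space_axioms vector_space_mult
        c.add c.scale s.add s.scale simp_thms)
  fix w assume "w \<in> Poly_Mapping.keys f"
  then have "w \<in> multilinear_words B n" using f by (auto simp: P_L_eq)
  then have ne: "w \<noteq> []" using multilinear_words_nonempty[OF _ n] by (auto simp: words_def)
  let ?w = "map (\<lambda>(i, h). (\<sigma> i, h)) w"
  have at: "at_0 (map (\<lambda>(i, h). (\<sigma> i, h)) v) = at_0 v" for v :: "(nat \<times> 'a poly) list"
    by (simp add: at_0_def comp_def case_prod_unfold)
  have at1: "at_1_0 ?w = at_1_0 w" "fst (hd ?w) = \<sigma> (fst (hd w))"
    using ne at[of "tl w"] by (cases w; auto simp: at_1_0_def)+
  have "\<sigma> n = n" using \<sigma> by (simp add: permutes_def)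
  then have "\<sigma> j = n \<longleftrightarrow> j = n" using permutes_inj[OF \<sigma>] by (metis injD)
  moreover have "\<sigma> k = \<sigma> j \<longleftrightarrow> k = j" for k using permutes_inj[OF \<sigma>] by (metis injD)
  ultimately show "coord n (\<sigma> j) (permute_vars \<sigma> (word w)) = coord n j (word w)"
    using ne by (simp only: push_single coord_word map_is_Nil_conv at at1 simp_thms not_False_eq_True)
qed (rule linear_coord)

lemma coordinates_M1:
  assumes "1 \<le> n"
  shows "quotient_coordinates pm_scale (P_L B n) (P_L B n \<inter> Id_L B M1) {..n} (coord n)
    (\<lambda>j. dprod (dual_word n j))"
proof (intro quotient_coordinates.intro quotient_coordinates_axioms.intro pm.vector_space_axioms)
  show "pm.subspace (P_L B n \<inter> Id_L B M1)"
    using ev1.T_L_ideal_Id_L by (intro pm.subspace_inter subspace_P_L) (simp add: T_L_ideal_def)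
  show "Vector_Spaces.linear pm_scale (*) (coord n j)" for j by (rule linear_coord)
  show "f \<in> P_L B n \<inter> Id_L B M1 \<longleftrightarrow> (\<forall>j\<in>{..n}. coord n j f = 0)" if "f \<in> P_L B n" for f
    using that multilinear_Id_M1_iff[OF assms that] by simp
  show "coord n i (dprod (dual_word n j)) = (if i = j then 1 else 0)" if "i \<in> {..n}" "j \<in> {..n}" for i j
    using that coord_dual[OF assms] by simp
qed (simp_all add: subspace_P_L dual_in_P_L)

lemma coordinates_M2:
  assumes n: "1 \<le> n"
  shows "quotient_coordinates pm_scale (P_L B n) (P_L B n \<inter> Id_L B M2) {..n}
    (\<lambda>j f. coord n j (reverse f)) (\<lambda>j. reverse (dprod (dual_word n j)))"
proof (intro quotient_coordinates.intro quotient_coordinates_axioms.intro pm.vector_space_axioms)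
  show "pm.subspace (P_L B n \<inter> Id_L B M2)"
    using flip.A'.T_L_ideal_Id_L by (intro pm.subspace_inter subspace_P_L) (simp add: T_L_ideal_def)
  interpret c: Vector_Spaces.linear pm_scale "(*)" "coord n j" for j by (rule linear_coord)
  show "Vector_Spaces.linear pm_scale (*) (\<lambda>f. coord n j (reverse f))" for j
    by (simp only: Vector_Spaces.linear_iff pm.vector_space_axioms vector_space_mult
        c.add c.scale reverse.add reverse.scale simp_thms)
  show "f \<in> P_L B n \<inter> Id_L B M2 \<longleftrightarrow> (\<forall>j\<in>{..n}. coord n j (reverse f) = 0)" if "f \<in> P_L B n" for f
    using that multilinear_Id_M1_iff[OF n reverse_P_L[OF that]] by (simp add: Id_L_M2_iff)
  show "coord n i (reverse (reverse (dprod (dual_word n j)))) = (if i = j then 1 else 0)"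
    if "i \<in> {..n}" "j \<in> {..n}" for i j
    using that coord_dual[OF n] by simp
qed (simp_all add: subspace_P_L reverse_P_L dual_in_P_L)

lemma codim_M1_M2:
  assumes "1 \<le> n"
  shows "codim_L B M1 n = n + 1" "codim_L B M2 n = n + 1"
  unfolding codim_L_def
    quotient_coordinates.quot_dim_eq[OF coordinates_M1[OF assms]]
    quotient_coordinates.quot_dim_eq[OF coordinates_M2[OF assms]] by simp_all

text \<open>
  In the given coordinates \<open>\<sigma>\<close> acts as a permutation of the indices \<open>0, \<dots>, n\<close>, so its trace counts
  fixed points; the extra fixed point is the index \<open>n\<close>.
\<close>

lemma sum_coord_permute:
  assumes \<sigma>: "\<sigma> permutes {..<n}" and n: "1 \<le> n"
  shows "(\<Sum>j\<le>n. coord n j (permute_vars \<sigma> (dprod (dual_word n j))))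
    = of_nat (card {j. j < n \<and> \<sigma> j = j}) + 1"
proof -
  have eq: "coord n j (permute_vars \<sigma> (dprod (dual_word n j))) = (if \<sigma> j = j then 1 else 0)"
    if j: "j \<le> n" for j
  proof -
    obtain i where i: "j = \<sigma> i" using permutes_surj[OF \<sigma>] by (metis surjD)
    then have "i \<le> n" using j \<sigma> by (metis le_less lessThan_iff not_le permutes_def permutes_in_image)
    then have "coord n j (permute_vars \<sigma> (dprod (dual_word n j))) = (if i = j then 1 else 0)"
      unfolding i coord_permute[OF \<sigma> n dual_in_P_L[OF j[unfolded i]]]
      using coord_dual[OF n _ j, of i] by (simp add: i)
    moreover have "\<sigma> j = j \<longleftrightarrow> i = j"
      using inj_eq[OF permutes_inj[OF \<sigma>], of i j] i by auto
    ultimately show ?thesis by simp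
  qed
  have "(\<Sum>j\<le>n. coord n j (permute_vars \<sigma> (dprod (dual_word n j))))
      = (\<Sum>j<Suc n. if \<sigma> j = j then 1 else 0)"
    by (rule sum.cong) (auto simp: eq lessThan_Suc_atMost)
  also have "\<dots> = (\<Sum>j<n. if \<sigma> j = j then 1 else 0) + 1"
    using \<sigma> by (simp add: permutes_def)
  also have "(\<Sum>j<n. if \<sigma> j = j then 1 else 0) = (of_nat (card {j. j < n \<and> \<sigma> j = j}) :: 'a)"
    by (simp add: sum.If_cases Int_def)
  finally show ?thesis .
qed

lemma permute_zero_coords:
  assumes \<sigma>: "\<sigma> permutes {..<n}" and n: "1 \<le> n" and f: "f \<in> P_L B n"
    and 0: "\<forall>j\<in>{..n}. coord n j f = 0"
  shows "\<forall>j\<in>{..n}. coord n j (permute_vars \<sigma> f) = 0"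
proof
  fix j assume j: "j \<in> {..n}"
  obtain i where i: "j = \<sigma> i" using permutes_surj[OF \<sigma>] by (metis surjD)
  then have "i \<le> n" using j \<sigma> by (metis atMost_iff le_less lessThan_iff not_le permutes_def permutes_in_image)
  then show "coord n j (permute_vars \<sigma> f) = 0"
    using coord_permute[OF \<sigma> n f, of i] i 0 by simp
qed

theorem cochar_M1_M2:
  assumes \<sigma>: "\<sigma> permutes {..<n}" and n: "1 \<le> n"
  shows "cochar_L B M1 n \<sigma> = of_nat (card {j. j < n \<and> \<sigma> j = j}) + 1"
    and "cochar_L B M2 n \<sigma> = of_nat (card {j. j < n \<and> \<sigma> j = j}) + 1"
proof -
  note inv = permute_vars_P_L[OF \<sigma>]
  have W1: "permute_vars \<sigma> f \<in> P_L B n \<inter> Id_L B M1" if "f \<in> P_L B n \<inter> Id_L B M1" for f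
  proof -
    have f: "f \<in> P_L B n" "f \<in> Id_L B M1" using that by blast+
    then show ?thesis
      using permute_zero_coords[OF \<sigma> n f(1)] inv[OF f(1)] by (simp add: multilinear_Id_M1_iff[OF n])
  qed
  have W2: "permute_vars \<sigma> f \<in> P_L B n \<inter> Id_L B M2" if "f \<in> P_L B n \<inter> Id_L B M2" for f
  proof -
    have f: "f \<in> P_L B n" "reverse f \<in> Id_L B M1" using that Id_L_M2_iff by blast+
    then show ?thesis
      using W1[of "reverse f"] reverse_P_L[OF f(1)] inv[OF f(1)]
      by (simp add: Id_L_M2_iff permute_vars_reverse)
  qed
  have "cochar_L B M1 n \<sigma> = (\<Sum>j\<le>n. coord n j (permute_vars \<sigma> (dprod (dual_word n j))))"
    unfolding cochar_L_def
    by (rule quotient_coordinates.quot_trace_eq[OF coordinates_M1[OF n] linear_push inv W1])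
  then show "cochar_L B M1 n \<sigma> = of_nat (card {j. j < n \<and> \<sigma> j = j}) + 1"
    by (simp only: sum_coord_permute[OF \<sigma> n])
  have "cochar_L B M2 n \<sigma> = (\<Sum>j\<le>n. coord n j (reverse (permute_vars \<sigma> (reverse (dprod (dual_word n j))))))"
    unfolding cochar_L_def
    by (rule quotient_coordinates.quot_trace_eq[OF coordinates_M2[OF n] linear_push inv W2])
  then show "cochar_L B M2 n \<sigma> = of_nat (card {j. j < n \<and> \<sigma> j = j}) + 1"
    by (simp only: permute_vars_reverse reverse_reverse sum_coord_permute[OF \<sigma> n])
qed

end

section \<open>The characters of the trivial and the standard representation\<close>

lemma lookup_sum_single:
  assumes "finite S"
  shows "Poly_Mapping.lookup (\<Sum>k\<in>S. Poly_Mapping.single k 1) x = (if x \<in> S then 1 else 0 :: 'a::field)"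
proof -
  have "Poly_Mapping.lookup (\<Sum>k\<in>S. Poly_Mapping.single k (1 :: 'a)) x = (\<Sum>k\<in>S. if k = x then 1 else 0)"
    by (simp add: lookup_sum lookup_single when_def)
  then show ?thesis using assms by simp
qed

lemma push_sum_single:
  assumes "inj_on g S"
  shows "push g (\<Sum>k\<in>S. Poly_Mapping.single k 1) = (\<Sum>k\<in>g ` S. Poly_Mapping.single k (1 :: 'a::field))"
proof -
  interpret g: Vector_Spaces.linear pm_scale pm_scale "push g" by (rule linear_push)
  show ?thesis
    by (simp only: g.sum push_single sum.reindex[OF assms] comp_def)
qed

text \<open>
  The basic elements \<open>perm_sum n i j\<close> of the group algebra are the sums over the cosets of permutations
  that send \<open>i\<close> to \<open>j\<close>.  Left multiplication by \<open>\<pi>\<close> changes \<open>j\<close> to \<open>\<pi> j\<close>.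
\<close>

definition perms_mapping :: "nat \<Rightarrow> nat \<Rightarrow> nat \<Rightarrow> (nat \<Rightarrow> nat) set" where
  "perms_mapping n i j = {\<rho>. \<rho> permutes {..<n} \<and> \<rho> i = j}"

definition perm_sum :: "nat \<Rightarrow> nat \<Rightarrow> nat \<Rightarrow> (nat \<Rightarrow> nat) \<Rightarrow>\<^sub>0 'a::field" where
  "perm_sum n i j = (\<Sum>\<rho>\<in>perms_mapping n i j. Poly_Mapping.single \<rho> 1)"

lemma finite_perms_mapping: "finite (perms_mapping n i j)"
  by (rule finite_subset[OF _ finite_permutations[of "{..<n}"]]) (auto simp: perms_mapping_def)

lemma perms_mapping_comp_left:
  assumes \<pi>: "\<pi> permutes {..<n}"
  shows "(\<circ>) \<pi> ` perms_mapping n i j = perms_mapping n i (\<pi> j)"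
proof (intro equalityI subsetI)
  fix \<rho> assume \<rho>: "\<rho> \<in> perms_mapping n i (\<pi> j)"
  have "inv \<pi> \<circ> \<rho> \<in> perms_mapping n i j"
    using \<rho> permutes_inv[OF \<pi>] permutes_inverses(2)[OF \<pi>]
    by (auto simp: perms_mapping_def intro: permutes_compose)
  moreover have "\<rho> = \<pi> \<circ> (inv \<pi> \<circ> \<rho>)"
    by (simp add: fun_eq_iff permutes_inverses(1)[OF \<pi>])
  ultimately show "\<rho> \<in> (\<circ>) \<pi> ` perms_mapping n i j" by blast
qed (use \<pi> in \<open>auto simp: perms_mapping_def intro: permutes_compose\<close>)

lemma push_perm_sum:
  assumes "\<pi> permutes {..<n}"
  shows "push ((\<circ>) \<pi>) (perm_sum n i j) = perm_sum n i (\<pi> j)"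
proof -
  have "inj_on ((\<circ>) \<pi>) (perms_mapping n i j)"
    using permutes_inj[OF assms] by (auto simp: inj_on_def fun_eq_iff dest: injD)
  then show ?thesis
    unfolding perm_sum_def by (simp add: push_sum_single perms_mapping_comp_left[OF assms])
qed

lemma lookup_perm_sum:
  "Poly_Mapping.lookup (perm_sum n i j) \<rho> = (if \<rho> permutes {..<n} \<and> \<rho> i = j then 1 else 0)"
  by (simp add: perm_sum_def lookup_sum_single[OF finite_perms_mapping]) (simp add: perms_mapping_def)

lemma sum_perm_sum:
  assumes "i < n"
  shows "(\<Sum>j<n. perm_sum n i j :: (nat \<Rightarrow> nat) \<Rightarrow>\<^sub>0 'a::field) = (\<Sum>\<rho> | \<rho> permutes {..<n}. Poly_Mapping.single \<rho> 1)"
proof (rule poly_mapping_eqI)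
  fix \<rho>
  have "Poly_Mapping.lookup (\<Sum>j<n. perm_sum n i j :: (nat \<Rightarrow> nat) \<Rightarrow>\<^sub>0 'a) \<rho>
      = (\<Sum>j<n. if \<rho> permutes {..<n} \<and> \<rho> i = j then 1 else 0)"
    by (simp only: lookup_sum lookup_perm_sum)
  also have "\<dots> = (if \<rho> permutes {..<n} then 1 else 0)"
    using permutes_in_image[of \<rho> "{..<n}" i] assms by auto
  also have "\<dots> = Poly_Mapping.lookup (\<Sum>\<rho> | \<rho> permutes {..<n}. Poly_Mapping.single \<rho> 1) \<rho>"
    by (simp only: lookup_sum_single[OF finite_permutations[OF finite_lessThan]] mem_Collect_eq)
  finally show "Poly_Mapping.lookup (\<Sum>j<n. perm_sum n i j :: (nat \<Rightarrow> nat) \<Rightarrow>\<^sub>0 'a) \<rho>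
      = Poly_Mapping.lookup (\<Sum>\<rho> | \<rho> permutes {..<n}. Poly_Mapping.single \<rho> 1) \<rho>" .
qed

lemma cell_one_row: "k < n \<Longrightarrow> cell [n] k = (0, k)"
  by simp

lemma young_sym_one_row: "young_sym [n] = (\<Sum>\<rho> | \<rho> permutes {..<n}. Poly_Mapping.single \<rho> 1)"
proof -
  have row: "row_stab [n] = {\<rho>. \<rho> permutes {..<n}}"
    using permutes_in_image by (fastforce simp: row_stab_def)
  have "\<tau> = id" if "\<tau> permutes {..<n}" "\<forall>k<n. snd (cell [n] (\<tau> k)) = snd (cell [n] k)" for \<tau>
  proof
    fix k
    show "\<tau> k = id k"
    proof (cases "k < n")
      case True
      then have "\<tau> k < n" using permutes_in_image[OF that(1), of k] by simp
      then show ?thesis using that(2) True by (metis cell_one_row id_apply snd_conv)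
    next
      case False
      then show ?thesis using that(1) by (simp add: permutes_def)
    qed
  qed
  then have col: "col_stab [n] = {id}"
    by (auto simp: col_stab_def permutes_id)
  show ?thesis unfolding young_sym_def row col by simp
qed

lemma irr_char_one_row:
  assumes \<sigma>: "\<sigma> permutes {..<n}"
  shows "irr_char [n] \<sigma> = (1 :: 'a::field)"
proof -
  define R :: "(nat \<Rightarrow> nat) \<Rightarrow>\<^sub>0 'a" where "R = (\<Sum>\<rho> | \<rho> permutes {..<n}. Poly_Mapping.single \<rho> 1)"
  have push: "push ((\<circ>) \<pi>) R = R" if \<pi>: "\<pi> permutes {..<n}" for \<pi>
  proof -
    have "inj_on ((\<circ>) \<pi>) {\<rho>. \<rho> permutes {..<n}}"
      using permutes_inj[OF \<pi>] by (auto simp: inj_on_def fun_eq_iff dest: injD)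
    then show ?thesis
      unfolding R_def using image_compose_permutations_left[OF \<pi>]
      by (simp add: push_sum_single setcompr_eq_image)
  qed
  have id: "Poly_Mapping.lookup R id = 1"
    by (simp add: R_def lookup_sum_single finite_permutations permutes_id)
  have "{push ((\<circ>) \<pi>) R | \<pi>. \<pi> permutes {..<n}} = {R}"
  proof (intro equalityI subsetI)
    fix x assume "x \<in> {push ((\<circ>) \<pi>) R | \<pi>. \<pi> permutes {..<n}}"
    then obtain \<pi> where "x = push ((\<circ>) \<pi>) R" "\<pi> permutes {..<n}" by (elim CollectE exE conjE)
    then show "x \<in> {R}" by (simp only: push singleton_iff)
  next
    fix x assume "x \<in> {R}"
    then show "x \<in> {push ((\<circ>) \<pi>) R | \<pi>. \<pi> permutes {..<n}}"
      by (intro CollectI exI[of _ id] conjI permutes_id) (simp only: push[OF permutes_id] singleton_iff)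
  qed
  then have V: "irr_module [n] = pm.span {R}"
    by (simp only: irr_module_def young_sym_one_row R_def[symmetric] sum_list.Cons sum_list.Nil add_0_right)
  have coords: "quotient_coordinates pm_scale (pm.span {R}) {0} {()}
      (\<lambda>_ f. Poly_Mapping.lookup f id) (\<lambda>_. R)"
  proof (intro quotient_coordinates.intro quotient_coordinates_axioms.intro pm.vector_space_axioms)
    show "f \<in> {0} \<longleftrightarrow> (\<forall>u\<in>{()}. Poly_Mapping.lookup f id = 0)" if "f \<in> pm.span {R}" for f
      using that id by (auto simp: pm.span_singleton)
  qed (simp_all add: pm.span_base pm.span_zero linear_lookup id)
  interpret s: Vector_Spaces.linear pm_scale pm_scale "push ((\<circ>) \<sigma>)" by (rule linear_push)
  have "irr_char [n] \<sigma> = (\<Sum>u\<in>{()}. Poly_Mapping.lookup (push ((\<circ>) \<sigma>) R) id)"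
    unfolding irr_char_def V
  proof (rule quotient_coordinates.quot_trace_eq[OF coords linear_push])
    show "push ((\<circ>) \<sigma>) f \<in> pm.span {R}" if "f \<in> pm.span {R}" for f
      using that push[OF \<sigma>] by (auto simp: pm.span_singleton s.scale)
    show "push ((\<circ>) \<sigma>) f \<in> {0}" if "f \<in> {0}" for f :: "(nat \<Rightarrow> nat) \<Rightarrow>\<^sub>0 'a"
      using that by (simp only: singleton_iff s.zero)
  qed
  then show ?thesis by (simp add: push[OF \<sigma>] id)
qed

lemma cell_hook:
  assumes "k \<le> m"
  shows "cell [m, Suc 0] k = (if k < m then (0, k) else (1, 0))"
  using assms by auto

lemma permutes_less_iff: "\<sigma> permutes {..<n} \<Longrightarrow> \<sigma> k < n \<longleftrightarrow> k < n"
  using permutes_in_image[of \<sigma> "{..<n}" k] by simp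

lemma row_stab_hook: "row_stab [m, 1] = perms_mapping (Suc m) m m"
proof (intro equalityI subsetI)
  fix \<sigma> assume "\<sigma> \<in> row_stab [m, 1]"
  then have \<sigma>: "\<sigma> permutes {..<Suc m}" and *: "\<And>k. k < Suc m \<Longrightarrow> fst (cell [m, 1] (\<sigma> k)) = fst (cell [m, 1] k)"
    by (auto simp: row_stab_def simp del: cell.simps)
  have "\<sigma> m \<le> m" using permutes_less_iff[OF \<sigma>, of m] by simp
  then have "\<sigma> m = m" using *[of m] by (simp add: cell_hook split: if_splits del: cell.simps)
  then show "\<sigma> \<in> perms_mapping (Suc m) m m" using \<sigma> by (simp add: perms_mapping_def)
next
  fix \<sigma> assume "\<sigma> \<in> perms_mapping (Suc m) m m"
  then have \<sigma>: "\<sigma> permutes {..<Suc m}" and m: "\<sigma> m = m" by (auto simp: perms_mapping_def)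
  have "fst (cell [m, 1] (\<sigma> k)) = fst (cell [m, 1] k)" if k: "k < Suc m" for k
  proof -
    have "\<sigma> k \<le> m" using permutes_less_iff[OF \<sigma>, of k] k by simp
    moreover have "\<sigma> k = m \<longleftrightarrow> k = m" using inj_eq[OF permutes_inj[OF \<sigma>], of k m] m by simp
    ultimately have "\<sigma> k < m \<longleftrightarrow> k < m" using k by linarith
    then show ?thesis using k \<open>\<sigma> k \<le> m\<close> by (simp add: cell_hook del: cell.simps)
  qed
  then show "\<sigma> \<in> row_stab [m, 1]" using \<sigma> by (simp add: row_stab_def del: cell.simps)
qed

lemma col_stab_hook:
  assumes m: "0 < m"
  shows "col_stab [m, 1] = {id, Transposition.transpose 0 m}"
proof (intro equalityI subsetI)
  let ?t = "Transposition.transpose 0 m"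
  fix \<tau> assume "\<tau> \<in> col_stab [m, 1]"
  then have \<tau>: "\<tau> permutes {..<Suc m}" and *: "\<And>k. k < Suc m \<Longrightarrow> snd (cell [m, 1] (\<tau> k)) = snd (cell [m, 1] k)"
    by (auto simp: col_stab_def simp del: cell.simps)
  have le: "\<tau> k \<le> m" if "k \<le> m" for k using permutes_less_iff[OF \<tau>, of k] that by simp
  have mid: "\<tau> k = k" if "0 < k" "k < m" for k
    using *[of k] le[of k] that by (simp add: cell_hook split: if_splits del: cell.simps)
  have ends: "\<tau> 0 \<in> {0, m}" "\<tau> m \<in> {0, m}"
    using *[of 0] le[of 0] *[of m] le[of m] m by (auto simp: cell_hook split: if_splits simp del: cell.simps)
  have "\<tau> 0 \<noteq> \<tau> m" using inj_eq[OF permutes_inj[OF \<tau>], of 0 m] m by simp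
  have out: "\<tau> k = k" if "m < k" for k using \<tau> that by (simp add: permutes_def)
  show "\<tau> \<in> {id, ?t}"
  proof (cases "\<tau> 0 = 0")
    case True
    then have "\<tau> m = m" using ends \<open>\<tau> 0 \<noteq> \<tau> m\<close> by auto
    then have "\<tau> k = id k" for k using True mid[of k] out[of k] by (cases "k = 0"; cases "k < m"; cases "k = m") auto
    then show ?thesis by auto
  next
    case False
    then have "\<tau> 0 = m" "\<tau> m = 0" using ends \<open>\<tau> 0 \<noteq> \<tau> m\<close> by auto
    then have "\<tau> k = ?t k" for k using mid[of k] out[of k]
      by (cases "k = 0"; cases "k < m"; cases "k = m") (auto simp: Transposition.transpose_def)
    then show ?thesis by auto
  qed
next
  let ?t = "Transposition.transpose 0 m"
  fix \<tau> assume "\<tau> \<in> {id, ?t}"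
  moreover have "?t permutes {..<Suc m}" by (rule permutes_swap_id) simp_all
  moreover have "snd (cell [m, 1] (?t k)) = snd (cell [m, 1] k)" if "k < Suc m" for k
    using that m by (simp add: Transposition.transpose_def cell_hook del: cell.simps)
  ultimately show "\<tau> \<in> col_stab [m, 1]"
    by (auto simp: col_stab_def permutes_id simp del: cell.simps)
qed

text \<open>
  The row stabilizer consists of the permutations that fix the last entry \<open>m\<close>, the column stabilizer
  is generated by the transposition of \<open>0\<close> and \<open>m\<close>; composing with it turns permutations that fix
  \<open>m\<close> into those that send \<open>0\<close> to \<open>m\<close>.
\<close>

lemma young_sym_hook:
  assumes m: "0 < m"
  shows "young_sym [m, 1] = perm_sum (Suc m) m m - perm_sum (Suc m) 0 m"
proof -
  let ?t = "Transposition.transpose 0 m" and ?S = "perms_mapping (Suc m) m m"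
  have t: "?t permutes {..<Suc m}" by (rule permutes_swap_id) simp_all
  have tt: "?t \<circ> ?t = id" by simp
  have ne: "id \<noteq> ?t" using m by (metis id_apply transpose_apply_first less_irrefl)
  have "inj_on (\<lambda>\<sigma>. \<sigma> \<circ> ?t) ?S"
    by (rule inj_onI) (metis comp_assoc comp_id tt)
  moreover have "(\<lambda>\<sigma>. \<sigma> \<circ> ?t) ` ?S = perms_mapping (Suc m) 0 m"
  proof (intro equalityI subsetI)
    fix \<rho> assume "\<rho> \<in> perms_mapping (Suc m) 0 m"
    then have "\<rho> \<circ> ?t \<in> ?S" using t by (auto simp: perms_mapping_def intro: permutes_compose)
    moreover have "\<rho> = (\<rho> \<circ> ?t) \<circ> ?t" by (simp add: comp_assoc)
    ultimately show "\<rho> \<in> (\<lambda>\<sigma>. \<sigma> \<circ> ?t) ` ?S" by blast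
  qed (use t in \<open>auto simp: perms_mapping_def intro: permutes_compose\<close>)
  ultimately have "(\<Sum>\<sigma>\<in>?S. Poly_Mapping.single (\<sigma> \<circ> ?t) 1) = perm_sum (Suc m) 0 m"
    unfolding perm_sum_def by (intro sum.reindex_cong[symmetric, of "\<lambda>\<sigma>. \<sigma> \<circ> ?t"]) auto
  moreover have "sign ?t = -1" using m by (simp add: sign_swap_id)
  ultimately show ?thesis
    unfolding young_sym_def row_stab_hook col_stab_hook[OF m]
    using ne by (simp add: sum.distrib sum_subtractf sum_negf single_uminus sign_id perm_sum_def)
qed

text \<open>
  The vectors \<open>v j\<close> with \<open>j \<le> m\<close> span the module and are permuted by the group.  Their sum is 0, both
  \<open>\<Sum>\<^sub>j perm_sum (m + 1) m j\<close> and \<open>\<Sum>\<^sub>j perm_sum (m + 1) 0 j\<close> being the sum of all permutations; so the \<open>v j\<close>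
  with \<open>j < m\<close> suffice.  They are independent: for \<open>j < m\<close> the permutation \<open>\<rho> j\<close> sends \<open>m\<close> to \<open>j\<close> and \<open>0\<close> to
  \<open>m\<close>, hence its coefficient is 1 in \<open>v j\<close>, is \<open>-1\<close> in \<open>v m\<close>, and is 0 in all other \<open>v k\<close>.
\<close>

lemma irr_char_hook:
  assumes m: "0 < m" and \<sigma>: "\<sigma> permutes {..<Suc m}"
  shows "irr_char [m, 1] \<sigma> = (of_nat (card {j. j < Suc m \<and> \<sigma> j = j}) - 1 :: 'a::field)"
proof -
  let ?N = "Suc m"
  define v :: "nat \<Rightarrow> (nat \<Rightarrow> nat) \<Rightarrow>\<^sub>0 'a" where "v j = perm_sum ?N m j - perm_sum ?N 0 j" for j
  define \<rho> where "\<rho> j = Transposition.transpose 0 j \<circ> Transposition.transpose 0 m" for j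
  have push: "push ((\<circ>) \<pi>) (v j) = v (\<pi> j)" if "\<pi> permutes {..<?N}" for \<pi> j
  proof -
    interpret p: Vector_Spaces.linear pm_scale pm_scale "push ((\<circ>) \<pi>)" by (rule linear_push)
    show ?thesis unfolding v_def p.diff push_perm_sum[OF that] ..
  qed
  have \<rho>: "\<rho> j permutes {..<?N}" "\<rho> j m = j" "\<rho> j 0 = m" if "j < m" for j
    using that m by (auto simp: \<rho>_def transpose_def intro!: permutes_compose permutes_swap_id)
  have coord: "Poly_Mapping.lookup (v k) (\<rho> j) = (if k = j then 1 else 0) - (if k = m then 1 else 0)"
    if "j < m" for j k
    using \<rho>[OF that] by (auto simp: v_def lookup_minus lookup_perm_sum)
  have "(\<Sum>j<?N. v j) = 0"
    unfolding v_def sum_subtractf by (simp only: sum_perm_sum lessI zero_less_Suc diff_self)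
  then have vm: "v m = - (\<Sum>j<m. v j)"
    by (simp add: eq_neg_iff_add_eq_0 add.commute)
  have gens: "{push ((\<circ>) \<pi>) (v m) | \<pi>. \<pi> permutes {..<?N}} = v ` {..<?N}"
  proof (intro equalityI subsetI)
    fix x assume "x \<in> {push ((\<circ>) \<pi>) (v m) | \<pi>. \<pi> permutes {..<?N}}"
    then obtain \<pi> where "x = push ((\<circ>) \<pi>) (v m)" and \<pi>: "\<pi> permutes {..<?N}"
      by (elim CollectE exE conjE)
    then have "x = v (\<pi> m)" by (simp only: push)
    with \<pi> show "x \<in> v ` {..<?N}" using permutes_less_iff[of \<pi> ?N m] by auto
  next
    fix x assume "x \<in> v ` {..<?N}"
    then obtain j where j: "j < ?N" "x = v j" by blast
    then have "Transposition.transpose m j permutes {..<?N}" by (intro permutes_swap_id) simp_all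
    moreover from this have "x = push ((\<circ>) (Transposition.transpose m j)) (v m)" by (simp only: push j(2) transpose_apply_first)
    ultimately show "x \<in> {push ((\<circ>) \<pi>) (v m) | \<pi>. \<pi> permutes {..<?N}}"
      by (intro CollectI exI[of _ "Transposition.transpose m j"] conjI)
  qed
  have V: "irr_module [m, 1] = pm.span (v ` {..<?N})"
  proof -
    have "young_sym [m, 1] = v m" by (simp only: young_sym_hook[OF m] v_def)
    moreover have "sum_list [m, 1] = ?N" by simp
    ultimately show ?thesis unfolding irr_module_def by (simp only: gens)
  qed
  have expand: "f = (\<Sum>j<m. pm_scale (Poly_Mapping.lookup f (\<rho> j)) (v j))" if "f \<in> pm.span (v ` {..<?N})" for f
    using that
  proof (induction rule: pm.span_induct_alt)
    case base
    show ?case by simp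
  next
    case (step c x y)
    then obtain k where k: "k < ?N" "x = v k" by blast
    have "v k = (\<Sum>j<m. pm_scale (Poly_Mapping.lookup (v k) (\<rho> j)) (v j))"
    proof (cases "k = m")
      case True
      have "(\<Sum>j<m. pm_scale (Poly_Mapping.lookup (v k) (\<rho> j)) (v j)) = (\<Sum>j<m. - v j)"
        using True m by (intro sum.cong) (auto simp: coord)
      also have "\<dots> = v m" unfolding vm by (rule sum_negf)
      finally show ?thesis unfolding True by simp
    next
      case False
      then have "(\<Sum>j<m. pm_scale (Poly_Mapping.lookup (v k) (\<rho> j)) (v j)) = (\<Sum>j<m. if k = j then v j else 0)"
        by (intro sum.cong) (auto simp: coord)
      then show ?thesis using k False by simp
    qed
    then have scaled: "pm_scale c x = (\<Sum>j<m. pm_scale (c * Poly_Mapping.lookup x (\<rho> j)) (v j))"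
      unfolding k(2) by (metis (no_types, lifting) pm.scale_scale pm.scale_sum_right sum.cong)
    have "(\<Sum>j<m. pm_scale (Poly_Mapping.lookup (pm_scale c x + y) (\<rho> j)) (v j))
        = (\<Sum>j<m. pm_scale (c * Poly_Mapping.lookup x (\<rho> j)) (v j))
          + (\<Sum>j<m. pm_scale (Poly_Mapping.lookup y (\<rho> j)) (v j))"
      by (simp only: lookup_add lookup_pm_scale pm.scale_left_distrib sum.distrib)
    also have "\<dots> = pm_scale c x + y"
      by (simp only: scaled[symmetric] step.IH[symmetric])
    finally show ?case by (rule sym)
  qed
  have coords: "quotient_coordinates pm_scale (pm.span (v ` {..<?N})) {0} {..<m}
      (\<lambda>j f. Poly_Mapping.lookup f (\<rho> j)) v"
  proof (intro quotient_coordinates.intro quotient_coordinates_axioms.intro pm.vector_space_axioms)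
    show "f \<in> {0} \<longleftrightarrow> (\<forall>j\<in>{..<m}. Poly_Mapping.lookup f (\<rho> j) = 0)" if "f \<in> pm.span (v ` {..<?N})" for f
      using expand[OF that] by auto
  qed (auto simp: linear_lookup coord pm.span_zero intro: pm.span_base)
  interpret s: Vector_Spaces.linear pm_scale pm_scale "push ((\<circ>) \<sigma>)" by (rule linear_push)
  have "irr_char [m, 1] \<sigma> = (\<Sum>j<m. Poly_Mapping.lookup (push ((\<circ>) \<sigma>) (v j)) (\<rho> j))"
    unfolding irr_char_def V
  proof (rule quotient_coordinates.quot_trace_eq[OF coords linear_push])
    show "push ((\<circ>) \<sigma>) f \<in> pm.span (v ` {..<?N})" if "f \<in> pm.span (v ` {..<?N})" for f
    proof -
      have "push ((\<circ>) \<sigma>) ` v ` {..<?N} \<subseteq> v ` {..<?N}"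
        using permutes_less_iff[OF \<sigma>] by (auto simp: push[OF \<sigma>])
      then have "pm.span (push ((\<circ>) \<sigma>) ` v ` {..<?N}) \<subseteq> pm.span (v ` {..<?N})" by (rule pm.span_mono)
      then show ?thesis using that unfolding s.span_image by blast
    qed
    show "push ((\<circ>) \<sigma>) f \<in> {0}" if "f \<in> {0}" for f :: "(nat \<Rightarrow> nat) \<Rightarrow>\<^sub>0 'a"
      using that by (simp only: singleton_iff s.zero)
  qed
  also have "\<dots> = (\<Sum>j<m. (if \<sigma> j = j then 1 else 0) - (if \<sigma> j = m then 1 else 0))"
    by (intro sum.cong) (simp_all add: push[OF \<sigma>] coord)
  \<comment> \<open>The two terms with index \<open>m\<close> cancel.\<close>
  also have "\<dots> = (\<Sum>j<?N. (if \<sigma> j = j then 1 else 0)) - (\<Sum>j<?N. if \<sigma> j = m then 1 else 0)"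
    by (simp add: sum_subtractf)
  also have "(\<Sum>j<?N. if \<sigma> j = m then 1 else (0 :: 'a)) = (\<Sum>j<?N. if j = inv \<sigma> m then 1 else 0)"
    by (intro sum.cong) (auto simp: permutes_inverses[OF \<sigma>])
  also have "\<dots> = 1"
    using permutes_less_iff[OF permutes_inv[OF \<sigma>], of m] by simp
  also have "(\<Sum>j<?N. (if \<sigma> j = j then 1 else (0 :: 'a))) = of_nat (card {j. j < ?N \<and> \<sigma> j = j})"
    by (simp add: sum.If_cases Int_def del: sum.lessThan_Suc)
  finally show ?thesis .
qed

theorem theorem6:
  fixes B :: "'a::field_char_0 poly set" and i j :: nat
  assumes "is_U_basis B" and "1 \<in> B" and "i \<noteq> j"
  shows "(let x = dvar B i; y = dvar B j in
      Id_L B M1 = T_L_gen B {x 1 * y eps,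
          x eps * y 1 - y eps * x 1 - (x 1 * y 1 - y 1 * x 1),
          x (eps ^ 2) - x eps}
    \<and> Id_L B M2 = T_L_gen B {x eps * y 1,
          x 1 * y eps - y 1 * x eps - (x 1 * y 1 - y 1 * x 1),
          x (eps ^ 2) - x eps})
    \<and> (\<forall>n\<ge>1. codim_L B M1 n = n + 1 \<and> codim_L B M2 n = n + 1)
    \<and> (\<forall>n\<ge>1. \<forall>\<sigma>. \<sigma> permutes {..<n} \<longrightarrow>
          cochar_L B M1 n \<sigma> = 2 * irr_char [n] \<sigma> + (if n = 1 then 0 else irr_char [n - 1, 1] \<sigma>)
        \<and> cochar_L B M2 n \<sigma> = 2 * irr_char [n] \<sigma> + (if n = 1 then 0 else irr_char [n - 1, 1] \<sigma>))"
proof -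
  interpret U_basis_char_0 B by unfold_locales (rule assms(1))
  have char: "2 * irr_char [n] \<sigma> + (if n = 1 then 0 else irr_char [n - 1, 1] \<sigma>)
      = (of_nat (card {j. j < n \<and> \<sigma> j = j}) + 1 :: 'a)"
    if n: "1 \<le> n" and \<sigma>: "\<sigma> permutes {..<n}" for n \<sigma>
  proof (cases "n = 1")
    case True
    then have "{j. j < n \<and> \<sigma> j = j} = {0}" using permutes_less_iff[OF \<sigma>, of 0] by auto
    then show ?thesis using True irr_char_one_row[OF \<sigma>, where 'a = 'a] by simp
  next
    case False
    then obtain m where m: "n = Suc m" "0 < m" using n by (cases n) auto
    then show ?thesis
      using irr_char_hook[OF m(2) \<sigma>[unfolded m(1)], where 'a = 'a]
      by (simp add: irr_char_one_row[OF \<sigma>[unfolded m(1)]])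
  qed
  show ?thesis
    unfolding Let_def
    using Id_L_M1[OF assms(3), of i] Id_L_M2[OF assms(3)] codim_M1_M2 cochar_M1_M2 char
    unfolding relations_M1_def relations_M2_def by simp
qed

end
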